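(* Let $r\ge0$, $a=r+4$, $V=\mathbb F_3^a=P\oplus R$ with $P=\mathbb F_3^4$ and $\dim R=r$, and equip $V$ with an alternating form $\omega$ whose radical is $R$ and whose restriction to $P$ is $\omega(x,y)=x_0y_1-x_1y_0+x_2y_3-x_3y_2$. Write $\bar v\in P$ for the projection of $v\in V$ along $R$. If $S=(v_i)_{i=1}^{n}$ is an indexed list of vectors of $V$ that is No-full, has length $n=2a+3$, and satisfies $\bar v_i\neq0$ for every index $i$, then $\Theta(S)=0$ in $\mathbb F_3$.
   Context: For an indexed list $S=(v_i)_{i=1}^n$ in $V$, a block is a subset $B\subseteq[n]$ of indices; it is vector-zero if $\sum_{i\in B}v_i=0$. The nonorthogonality graph of $B$ has vertex set $B$, with $i,j$ adjacent when $\omega(v_i,v_j)\neq0$. A triple $\{i,j,k\}$ of indices is balanced if $\omega(v_i,v_j)=\omega(v_j,v_k)=\omega(v_k,v_i)\neq0$ (independent of the ordering chosen). The list $S$ is No-full if for every vector-zero block $B$ the nonorthogonality graph of $B$ either has no edges (the block is commuting) or consists of exactly one balanced triangle together with isolated vertices. For an index set $Y\subseteq[n]$ put \[ N(Y)=\sum_{B\subseteq[n],\ \sum_{i\in B}v_i=0,\ Y\subseteq B}(-1)^{|B|}\in\mathbb F_3 \] (the empty block is included when $Y=\varnothing$). For a balanced triple $K$ put $\mu_K=-N(K)$, and $\Theta(S)=\sum_{K\text{ balanced}}\mu_K\in\mathbb F_3$. *)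

theory Defs
  imports "HOL-Analysis.Cartesian_Space" "HOL-Library.Numeral_Type"
begin

(* The field with three elements; the library makes finite_3 an instance of class field. *)
type_synonym F3 = Enum.finite_3

lemma card_F3: "CARD(F3) = 3"
  by (simp add: UNIV_finite_3)

(* The library declares 0 = a1, 1 = a2 and 2 = a3 as simp rules, which hides 0 and 1 from
   the generic ring simplification rules. *)
declare zero_finite_3_def [simp del] one_finite_3_def [simp del] two_finite_3 [simp del]


section \<open>Direct sums and alternating forms\<close>

definition direct_sum :: "('a::field ^ 'd) set \<Rightarrow> ('a ^ 'd) set \<Rightarrow> bool" where
  "direct_sum P R \<longleftrightarrow> vec.subspace P \<and> vec.subspace R \<and> P \<inter> R = {0} \<and>
     {p + q | p q. p \<in> P \<and> q \<in> R} = UNIV"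

(* Projection onto P along R; well defined only if the space is the direct sum of P and R. *)
definition proj_along :: "('a::field ^ 'd) set \<Rightarrow> ('a ^ 'd) set \<Rightarrow> 'a ^ 'd \<Rightarrow> 'a ^ 'd" where
  "proj_along P R v = (THE p. p \<in> P \<and> v - p \<in> R)"

definition alternating_form :: "('a::field ^ 'd \<Rightarrow> 'a ^ 'd \<Rightarrow> 'a) \<Rightarrow> bool" where
  "alternating_form \<omega> \<longleftrightarrow>
     (\<forall>x. Vector_Spaces.linear (*s) (*) (\<lambda>y. \<omega> x y)) \<and>
     (\<forall>y. Vector_Spaces.linear (*s) (*) (\<lambda>x. \<omega> x y)) \<and>
     (\<forall>x. \<omega> x x = 0)"

definition radical :: "('a::field ^ 'd \<Rightarrow> 'a ^ 'd \<Rightarrow> 'a) \<Rightarrow> ('a ^ 'd) set" where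
  "radical \<omega> = {x. \<forall>y. \<omega> x y = 0}"

definition symplectic4 :: "F3 ^ 4 \<Rightarrow> F3 ^ 4 \<Rightarrow> F3" where
  "symplectic4 x y = x $ 0 * y $ 1 - x $ 1 * y $ 0 + x $ 2 * y $ 3 - x $ 3 * y $ 2"


section \<open>Blocks of an indexed list\<close>

(* Indices run over 0, ..., n - 1, where n is the length of the list. *)

definition vector_zero :: "(F3 ^ 'd) list \<Rightarrow> nat set \<Rightarrow> bool" where
  "vector_zero S B \<longleftrightarrow> B \<subseteq> {..<length S} \<and> (\<Sum>i\<in>B. S ! i) = 0"

(* The graph has vertex set B. Loops do not occur for an alternating form. *)
definition nonorth_edges ::
    "(F3 ^ 'd \<Rightarrow> F3 ^ 'd \<Rightarrow> F3) \<Rightarrow> (F3 ^ 'd) list \<Rightarrow> nat set \<Rightarrow> nat set set" where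
  "nonorth_edges \<omega> S B = {{i, j} | i j. i \<in> B \<and> j \<in> B \<and> i \<noteq> j \<and> \<omega> (S ! i) (S ! j) \<noteq> 0}"

(* For an alternating form the condition does not depend on the enumeration i, j, k of K:
   cyclic shifts permute the three values and transpositions negate all of them. *)
definition balanced :: "(F3 ^ 'd \<Rightarrow> F3 ^ 'd \<Rightarrow> F3) \<Rightarrow> (F3 ^ 'd) list \<Rightarrow> nat set \<Rightarrow> bool" where
  "balanced \<omega> S K \<longleftrightarrow> (\<exists>i j k. K = {i, j, k} \<and> distinct [i, j, k] \<and> K \<subseteq> {..<length S} \<and>
     \<omega> (S ! i) (S ! j) = \<omega> (S ! j) (S ! k) \<and> \<omega> (S ! j) (S ! k) = \<omega> (S ! k) (S ! i) \<and>
     \<omega> (S ! k) (S ! i) \<noteq> 0)"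

(* The second alternative: the edges are exactly the three 2-subsets of a balanced triple K,
   so all vertices of B outside K are isolated. *)
definition no_full :: "(F3 ^ 'd \<Rightarrow> F3 ^ 'd \<Rightarrow> F3) \<Rightarrow> (F3 ^ 'd) list \<Rightarrow> bool" where
  "no_full \<omega> S \<longleftrightarrow> (\<forall>B. vector_zero S B \<longrightarrow>
     nonorth_edges \<omega> S B = {} \<or>
     (\<exists>K. K \<subseteq> B \<and> balanced \<omega> S K \<and> nonorth_edges \<omega> S B = {e. e \<subseteq> K \<and> card e = 2}))"

definition block_count :: "(F3 ^ 'd) list \<Rightarrow> nat set \<Rightarrow> F3" where
  "block_count S Y = (\<Sum>B | vector_zero S B \<and> Y \<subseteq> B. (-1) ^ card B)"

definition mu :: "(F3 ^ 'd) list \<Rightarrow> nat set \<Rightarrow> F3" where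
  "mu S K = - block_count S K"

definition Theta :: "(F3 ^ 'd \<Rightarrow> F3 ^ 'd \<Rightarrow> F3) \<Rightarrow> (F3 ^ 'd) list \<Rightarrow> F3" where
  "Theta \<omega> S = (\<Sum>K | balanced \<omega> S K. mu S K)"

end

theory Submission
  imports Defs
begin

text \<open>
  By the polynomial method every set \<open>Y\<close> of at most two indices has signed count \<open>N Y = 0\<close>: the
  condition that a block sums to zero is a product of \<open>2a\<close> affine functions of its indicator vector.
  Hence \<open>N\<close> sums to zero over the triangles through any edge.

  A zero-sum block over a triangle \<open>K\<close> with \<open>P = \<Sum>i\<in>K. b i\<close> nonzero consists of \<open>K\<close> and indices lying
  over \<open>\<plusminus>P\<close>. Disjoint zero-sum blocks are orthogonal, which strongly restricts pairs of triangles with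
  non-orthogonal \<open>P\<close>, \<open>P'\<close>: quadratic polynomials detecting the blocks over \<open>K\<close> force \<open>N K = 0\<close>
  or orthogonality relations between the two triangles.

  Summing \<open>N\<close> over all triangles with given projections \<open>u, v, w\<close> gives \<open>weight u v w\<close>. The relations
  show that all points \<open>\<plusminus>P\<close> coming from the three edges of a triangle of nonzero weight agree.
  Comparing cosets modulo that point then selects one of the three edges: it produces a
  function \<open>f\<close> with \<open>f u v + f v w + f w u = 1\<close> on every triangle of nonzero weight. Thus the sum
  of all weights is a combination of the sums over the triangles through an edge, which vanish.
\<close>

section \<open>Signed counts of zero-sum blocks\<close>

lemma F3_cases: "(x::F3) = 0 \<or> x = 1 \<or> x = -1"
  by (cases x) (simp_all add: zero_finite_3_def one_finite_3_def uminus_finite_3_def)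

lemma F3_numerals [simp]: "(2::F3) = -1" "(3::F3) = 0" "(4::F3) = 1"
proof -
  show *: "(2::F3) = -1"
    by (simp add: two_finite_3 one_finite_3_def uminus_finite_3_def)
  have "(3::F3) = 2 + 1" "(4::F3) = 2 + 2" by simp_all
  then show "(3::F3) = 0" "(4::F3) = 1"
    unfolding * by (simp_all add: zero_finite_3_def one_finite_3_def uminus_finite_3_def plus_finite_3_def)
qed

lemma F3_one_neq [simp]: "(1::F3) \<noteq> -1" "(-1::F3) \<noteq> 1"
  by (simp_all add: one_finite_3_def uminus_finite_3_def)

lemma F3_double: "(x::F3) + x = - x"
  using F3_cases[of x] by auto

lemma F3_square: "(x::F3) \<noteq> 0 \<Longrightarrow> x * x = 1"
  using F3_cases[of x] by auto

lemma F3_vector_double: "(x :: F3 ^ 'n) + x = - x"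
  by (simp add: vec_eq_iff F3_double)

text \<open>After exchanging the sums, a set containing \<open>i\<close> is
  \<open>insert i B\<close> with \<open>B\<close> inside \<open>X - {i}\<close>, and the sign flips.
  A linear factor is thus traded for the loss of one index.\<close>

lemma sum_Pow_restrict:
  assumes "finite X"
  shows "(\<Sum>B\<in>Pow X. (-1) ^ card B * sum \<alpha> B * g B) =
    - (\<Sum>i\<in>X. \<alpha> i * (\<Sum>B\<in>Pow (X - {i}). (-1::'a::comm_ring_1) ^ card B * g (insert i B)))"
proof -
  have "(\<Sum>B\<in>Pow X. (-1) ^ card B * sum \<alpha> B * g B) =
      (\<Sum>B\<in>Pow X. \<Sum>i\<in>X. if i \<in> B then (-1::'a) ^ card B * \<alpha> i * g B else 0)"
  proof (rule sum.cong[OF refl])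
    fix B assume "B \<in> Pow X"
    then have "X \<inter> B = B" by auto
    with assms show "(-1) ^ card B * sum \<alpha> B * g B =
        (\<Sum>i\<in>X. if i \<in> B then (-1::'a) ^ card B * \<alpha> i * g B else 0)"
      by (simp add: sum.inter_restrict[symmetric] sum_distrib_left sum_distrib_right)
  qed
  also have "\<dots> = (\<Sum>i\<in>X. \<Sum>B\<in>Pow X. if i \<in> B then (-1::'a) ^ card B * \<alpha> i * g B else 0)"
    by (rule sum.swap)
  also have "\<dots> = (\<Sum>i\<in>X. - (\<alpha> i * (\<Sum>B\<in>Pow (X - {i}). (-1::'a) ^ card B * g (insert i B))))"
  proof (rule sum.cong[OF refl])
    fix i assume i: "i \<in> X"
    have "(\<Sum>B\<in>Pow X. if i \<in> B then (-1::'a) ^ card B * \<alpha> i * g B else 0) =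
        (\<Sum>B\<in>{B\<in>Pow X. i \<in> B}. (-1::'a) ^ card B * \<alpha> i * g B)"
      by (rule sum.inter_filter[symmetric]) (simp add: assms)
    also have "\<dots> = (\<Sum>B\<in>Pow (X - {i}). (-1::'a) ^ card (insert i B) * \<alpha> i * g (insert i B))"
      by (rule sum.reindex_bij_witness[of _ "insert i" "\<lambda>B. B - {i}"]) (use i in \<open>auto simp: insert_absorb\<close>)
    also have "\<dots> = - (\<alpha> i * (\<Sum>B\<in>Pow (X - {i}). (-1::'a) ^ card B * g (insert i B)))"
      unfolding sum_distrib_left sum_negf[symmetric]
    proof (rule sum.cong[OF refl])
      fix B assume "B \<in> Pow (X - {i})"
      then have "finite B" "i \<notin> B" using assms finite_subset by auto
      then show "(-1::'a) ^ card (insert i B) * \<alpha> i * g (insert i B) =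
          - (\<alpha> i * ((-1) ^ card B * g (insert i B)))"
        by simp
    qed
    finally show "(\<Sum>B\<in>Pow X. if i \<in> B then (-1::'a) ^ card B * \<alpha> i * g B else 0) =
        - (\<alpha> i * (\<Sum>B\<in>Pow (X - {i}). (-1::'a) ^ card B * g (insert i B)))" .
  qed
  finally show ?thesis by (simp add: sum_negf)
qed

text \<open>The product has degree below \<open>card X\<close> in the indicator variables, so no
  monomial involves all of \<open>X\<close>, and the alternating sum kills every other monomial. The
  induction peels off one factor: its constant part costs a factor, its linear part costs a factor
  and an index.\<close>

lemma signed_sum_prod_affine:
  fixes fs :: "('a::comm_ring_1 \<times> ('i \<Rightarrow> 'a)) list"
  assumes "finite X" "length fs < card X"
  shows "(\<Sum>B\<in>Pow X. (-1) ^ card B * (\<Prod>(c, \<alpha>)\<leftarrow>fs. c + sum \<alpha> B)) = 0"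
  using assms
proof (induction "length fs" arbitrary: X fs)
  case 0
  then obtain x where x: "x \<in> X" by fastforce
  have X: "insert x (X - {x}) = X" using x by auto
  have "(\<Sum>B\<in>Pow X. (-1::'a) ^ card B) =
      (\<Sum>B\<in>Pow (X - {x}). (-1) ^ card B) + (\<Sum>B\<in>insert x ` Pow (X - {x}). (-1) ^ card B)"
    by (subst X[symmetric], subst Pow_insert, rule sum.union_disjoint) (use 0 in auto)
  also have "(\<Sum>B\<in>insert x ` Pow (X - {x}). (-1::'a) ^ card B) =
      (\<Sum>B\<in>Pow (X - {x}). (-1) ^ card (insert x B))"
    by (rule sum.reindex_cong[OF inj_on_subset[of "insert x" "Pow (X - {x})"]])
      (auto simp: inj_on_def)
  also have "\<dots> = (\<Sum>B\<in>Pow (X - {x}). - ((-1) ^ card B))"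
  proof (rule sum.cong[OF refl])
    fix B assume "B \<in> Pow (X - {x})"
    then have "finite B" "x \<notin> B" using 0 finite_subset by auto
    then show "(-1::'a) ^ card (insert x B) = - ((-1) ^ card B)" by simp
  qed
  finally show ?case using 0 by (simp add: sum_negf)
next
  case (Suc m)
  obtain c \<alpha> fs' where fs: "fs = (c, \<alpha>) # fs'" using Suc.hyps(2) by (cases fs) auto
  let ?g = "\<lambda>fs B. \<Prod>(c, \<alpha>)\<leftarrow>fs. c + sum \<alpha> B"
  have m: "m = length fs'" using Suc.hyps(2) fs by simp
  have IH: "(\<Sum>B\<in>Pow X'. (-1) ^ card B * ?g fs'' B) = 0"
    if "length fs'' = length fs'" "finite X'" "length fs' < card X'"
    for X' and fs'' :: "('a \<times> ('i \<Rightarrow> 'a)) list"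
    using Suc.hyps(1)[of fs'' X'] that m by simp
  have shift: "(\<Sum>B\<in>Pow (X - {i}). (-1) ^ card B * ?g fs' (insert i B)) = 0" if i: "i \<in> X" for i
  proof -
    \<comment> \<open>Membership of \<open>i\<close> is now fixed, so its coefficient moves into the
      constant term.\<close>
    let ?fs = "map (\<lambda>(c, \<alpha>). (c + \<alpha> i, \<alpha>)) fs'"
    have "(\<Sum>B\<in>Pow (X - {i}). (-1) ^ card B * ?g fs' (insert i B)) =
        (\<Sum>B\<in>Pow (X - {i}). (-1) ^ card B * ?g ?fs B)"
    proof (rule sum.cong[OF refl])
      fix B assume "B \<in> Pow (X - {i})"
      then have "finite B" "i \<notin> B" using Suc.prems finite_subset by auto
      then have "?g fs' (insert i B) = ?g ?fs B"
        by (auto intro!: arg_cong[where f = prod_list] simp: add.assoc o_def case_prod_beta)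
      then show "(-1) ^ card B * ?g fs' (insert i B) = (-1) ^ card B * ?g ?fs B" by simp
    qed
    also have "\<dots> = 0" by (rule IH) (use Suc.prems fs i in auto)
    finally show ?thesis .
  qed
  have "(\<Sum>B\<in>Pow X. (-1) ^ card B * ?g fs B) =
      c * (\<Sum>B\<in>Pow X. (-1) ^ card B * ?g fs' B) +
      (\<Sum>B\<in>Pow X. (-1) ^ card B * sum \<alpha> B * ?g fs' B)"
    by (simp add: fs sum_distrib_left sum.distrib[symmetric] algebra_simps)
  also have "(\<Sum>B\<in>Pow X. (-1) ^ card B * ?g fs' B) = 0"
    by (rule IH) (use Suc.prems fs in auto)
  also have "(\<Sum>B\<in>Pow X. (-1) ^ card B * sum \<alpha> B * ?g fs' B) = 0"
    unfolding sum_Pow_restrict[OF Suc.prems(1)] by (simp add: shift)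
  finally show ?case by simp
qed

text \<open>Over \<open>F3\<close>, \<open>(1 - s) * (1 + s)\<close> is the indicator of
  \<open>s = 0\<close>. The \<open>CARD('d)\<close> coordinates therefore give
  \<open>2 * CARD('d)\<close> affine factors, fewer than the indices outside \<open>Y\<close>; the
  contribution \<open>h\<close> of \<open>Y\<close> itself is constant.\<close>

lemma block_count_eq_0:
  fixes S :: "(F3 ^ 'd) list"
  assumes Y: "Y \<subseteq> {..<length S}" and card: "2 * CARD('d) + card Y < length S"
  shows "block_count S Y = 0"
proof -
  define X where "X = {..<length S} - Y"
  have fin: "finite X" "finite Y" using Y finite_subset by (auto simp: X_def)
  obtain ds :: "'d list" where ds: "set ds = UNIV" "distinct ds"
    using finite_distinct_list[OF finite_class.finite_UNIV] by blast
  have len: "length ds = CARD('d)" using ds distinct_card by metis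
  define h where "h c = (\<Sum>i\<in>Y. S ! i $ c)" for c
  define fs where "fs = map (\<lambda>c. (1 - h c, \<lambda>i. - (S ! i $ c))) ds @ map (\<lambda>c. (1 + h c, \<lambda>i. S ! i $ c)) ds"
  have ind: "(\<Prod>(c, \<alpha>)\<leftarrow>fs. c + sum \<alpha> B) = (if (\<Sum>i\<in>Y \<union> B. S ! i) = 0 then 1 else 0)" if "B \<subseteq> X" for B
  proof -
    have B: "finite B" "Y \<inter> B = {}" using that fin finite_subset by (auto simp: X_def)
    define s where "s c = (\<Sum>i\<in>Y \<union> B. S ! i) $ c" for c
    have s: "s c = h c + (\<Sum>i\<in>B. S ! i $ c)" for c
      using B fin by (simp add: s_def h_def sum.union_disjoint)
    have "(\<Prod>(c, \<alpha>)\<leftarrow>fs. c + sum \<alpha> B) = (\<Prod>c\<leftarrow>ds. 1 - s c) * (\<Prod>c\<leftarrow>ds. 1 + s c)"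
      by (simp add: fs_def o_def s sum_negf algebra_simps)
    also have "\<dots> = (\<Prod>c\<in>UNIV. 1 - s c) * (\<Prod>c\<in>UNIV. 1 + s c)"
      using ds by (metis prod.distinct_set_conv_list)
    also have "\<dots> = (\<Prod>c\<in>UNIV. 1 - s c * s c)"
      by (simp add: prod.distrib[symmetric] algebra_simps)
    also have "\<dots> = (if (\<Sum>i\<in>Y \<union> B. S ! i) = 0 then 1 else 0)"
    proof (cases "(\<Sum>i\<in>Y \<union> B. S ! i) = 0")
      case True
      then show ?thesis by (simp add: s_def)
    next
      case False
      then obtain c where "s c \<noteq> 0" by (auto simp: s_def vec_eq_iff)
      then have "1 - s c * s c = 0" by (simp add: F3_square)
      then have "(\<Prod>c\<in>UNIV. 1 - s c * s c) = 0" by (intro prod_zero) auto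
      with False show ?thesis by simp
    qed
    finally show ?thesis .
  qed
  have "block_count S Y = (\<Sum>B\<in>{B \<in> Pow X. (\<Sum>i\<in>Y \<union> B. S ! i) = 0}. (-1) ^ card (Y \<union> B))"
    unfolding block_count_def vector_zero_def
    by (rule sum.reindex_bij_witness[of _ "\<lambda>B. Y \<union> B" "\<lambda>B. B - Y"])
      (use Y in \<open>auto simp: X_def Un_absorb1 Diff_partition intro: arg_cong[where f=card]\<close>)
  also have "\<dots> = (\<Sum>B\<in>Pow X. if (\<Sum>i\<in>Y \<union> B. S ! i) = 0 then (-1) ^ card (Y \<union> B) else 0)"
    by (rule sum.inter_filter) (simp add: fin)
  also have "\<dots> = (\<Sum>B\<in>Pow X. (-1) ^ card Y * ((-1) ^ card B * (\<Prod>(c, \<alpha>)\<leftarrow>fs. c + sum \<alpha> B)))"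
  proof (rule sum.cong[OF refl])
    fix B assume B: "B \<in> Pow X"
    then have "finite B" "Y \<inter> B = {}" using fin finite_subset by (auto simp: X_def)
    then have "card (Y \<union> B) = card Y + card B" using fin by (simp add: card_Un_disjoint)
    then show "(if (\<Sum>i\<in>Y \<union> B. S ! i) = 0 then (-1) ^ card (Y \<union> B) else 0) =
        (-1::F3) ^ card Y * ((-1) ^ card B * (\<Prod>(c, \<alpha>)\<leftarrow>fs. c + sum \<alpha> B))"
      using B by (simp add: ind power_add)
  qed
  also have "\<dots> = (-1) ^ card Y * (\<Sum>B\<in>Pow X. (-1) ^ card B * (\<Prod>(c, \<alpha>)\<leftarrow>fs. c + sum \<alpha> B))"
    by (simp add: sum_distrib_left)
  also have "\<dots> = 0"
  proof -
    have "card X = length S - card Y" using Y fin by (simp add: X_def card_Diff_subset)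
    then have "length fs < card X" using card len by (simp add: fs_def)
    then show ?thesis using signed_sum_prod_affine[OF fin(1)] by simp
  qed
  finally show ?thesis .
qed

section \<open>The symplectic form on \<open>F3 ^ 4\<close>\<close>

abbreviation (input) sp :: "F3 ^ 4 \<Rightarrow> F3 ^ 4 \<Rightarrow> F3" where "sp \<equiv> symplectic4"

lemma sp_bilinear [simp]:
  "sp (x + y) z = sp x z + sp y z" "sp x (y + z) = sp x y + sp x z"
  "sp (x - y) z = sp x z - sp y z" "sp x (y - z) = sp x y - sp x z"
  "sp (- x) z = - sp x z" "sp x (- z) = - sp x z"
  "sp (a *s x) z = a * sp x z" "sp x (a *s z) = a * sp x z"
  "sp 0 z = 0" "sp x 0 = 0"
  by (simp_all add: symplectic4_def algebra_simps)

lemma sp_self [simp]: "sp x x = 0"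
  by (simp add: symplectic4_def algebra_simps)

lemma sp_swap: "sp y x = - sp x y"
  by (simp add: symplectic4_def algebra_simps)

lemma forall_4_from_0: "(\<forall>i::4. Q i) \<longleftrightarrow> Q 0 \<and> Q 1 \<and> Q 2 \<and> Q 3"
proof -
  have "(4::4) = 0" by simp
  then show ?thesis by (simp only: forall_4) blast
qed

lemma sp_nondegenerate:
  assumes "x \<noteq> 0" obtains y where "sp x y \<noteq> 0"
proof -
  have "\<not> (x $ 0 = 0 \<and> x $ 1 = 0 \<and> x $ 2 = 0 \<and> x $ 3 = 0)"
    using assms by (auto simp: vec_eq_iff forall_4_from_0)
  moreover have "sp x (axis 1 1) = x $ 0" "sp x (axis 0 1) = - x $ 1"
      "sp x (axis 3 1) = x $ 2" "sp x (axis 2 1) = - x $ 3"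
    by (simp_all add: symplectic4_def axis_def)
  ultimately show ?thesis using that[of "axis 1 1"] that[of "axis 0 1"] that[of "axis 3 1"] that[of "axis 2 1"]
    by fastforce
qed

text \<open>The vectors form two mutually orthogonal hyperbolic pairs. The map recording the four
  pairings is surjective, hence injective because the space is finite.\<close>

lemma sp_basis_eq_0:
  assumes uv: "sp u v \<noteq> 0" and PQ: "sp P Q \<noteq> 0"
    and orth: "sp u P = 0" "sp u Q = 0" "sp v P = 0" "sp v Q = 0"
    and q: "sp q u = 0" "sp q v = 0" "sp q P = 0" "sp q Q = 0"
  shows "q = 0"
proof -
  define f :: "F3 ^ 4 \<Rightarrow> F3 ^ 4" where
    "f q = (\<chi> i. if i = 0 then sp q u else if i = 1 then sp q v else if i = 2 then sp q P else sp q Q)" for q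
  define c d where "c = sp u v" and "d = sp P Q"
  have sq: "c * c = 1" "d * d = 1"
    using uv PQ by (simp_all add: F3_square c_def d_def)
  have vals: "sp u v = c" "sp P Q = d" "sp v u = - c" "sp Q P = - d"
      "sp P u = 0" "sp Q u = 0" "sp P v = 0" "sp Q v = 0"
    using orth sp_swap[of v u] sp_swap[of Q P] sp_swap[of P u] sp_swap[of Q u] sp_swap[of P v] sp_swap[of Q v]
    by (simp_all add: c_def d_def)
  \<comment> \<open>An explicit right inverse of \<open>f\<close>: each coordinate is realised by
    the partner in its hyperbolic pair, and \<open>c\<close>, \<open>d\<close> are their own
    inverses.\<close>
  define g where "g y = - (y $ 0 * c) *s v + (y $ 1 * c) *s u - (y $ 2 * d) *s Q + (y $ 3 * d) *s P" for y :: "F3 ^ 4"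
  have "sp (g y) u = y $ 0 * (c * c)" "sp (g y) v = y $ 1 * (c * c)"
      "sp (g y) P = y $ 2 * (d * d)" "sp (g y) Q = y $ 3 * (d * d)" for y
    by (simp_all add: g_def vals orth mult.assoc)
  then have "f (g y) = y" for y
    by (simp add: vec_eq_iff forall_4_from_0 f_def sq)
  then have "surj f" by (rule surjI)
  then have "inj f" by (rule finite_UNIV_surj_inj[OF finite_class.finite_UNIV])
  moreover have "f q = f 0" by (simp add: f_def vec_eq_iff q)
  ultimately show ?thesis by (simp add: inj_eq)
qed

text \<open>Nonzero scalars of \<open>F3\<close> are self-inverse, so the factors
  \<open>sp u v\<close> and \<open>sp P Q\<close> stand for division. The difference of both sides
  is orthogonal to the whole basis.\<close>

lemma sp_basis_expansion:
  assumes uv: "sp u v \<noteq> 0" and PQ: "sp P Q \<noteq> 0"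
    and orth: "sp u P = 0" "sp u Q = 0" "sp v P = 0" "sp v Q = 0"
  shows "q = (sp u v * sp q v) *s u - (sp u v * sp q u) *s v + (sp P Q * sp q Q) *s P - (sp P Q * sp q P) *s Q"
proof -
  define c d where "c = sp u v" and "d = sp P Q"
  have sq: "c * (a * c) = a" "d * (a * d) = a" for a
    using uv PQ F3_cases[of c] F3_cases[of d] by (auto simp: c_def d_def)
  have vals: "sp u v = c" "sp P Q = d" "sp v u = - c" "sp Q P = - d"
      "sp P u = 0" "sp Q u = 0" "sp P v = 0" "sp Q v = 0"
    using orth sp_swap[of v u] sp_swap[of Q P] sp_swap[of P u] sp_swap[of Q u] sp_swap[of P v] sp_swap[of Q v]
    by (simp_all add: c_def d_def)
  define r where "r = (c * sp q v) *s u - (c * sp q u) *s v + (d * sp q Q) *s P - (d * sp q P) *s Q"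
  have "sp r u = sp q u" "sp r v = sp q v" "sp r P = sp q P" "sp r Q = sp q Q"
    by (simp_all add: r_def vals orth mult.assoc sq)
  then have "q - r = 0"
    by (intro sp_basis_eq_0[OF uv PQ orth]) simp_all
  then show ?thesis by (simp add: r_def c_def d_def)
qed

text \<open>The orthogonal complement of a hyperbolic plane is again a nondegenerate plane, in which
  only multiples of \<open>P\<close> are orthogonal to \<open>P\<close>.\<close>

lemma sp_parallel:
  assumes uv: "sp u v \<noteq> 0" and P: "P \<noteq> 0" "sp u P = 0" "sp v P = 0"
    and Q: "sp u Q = 0" "sp v Q = 0" and PQ: "sp P Q = 0"
  shows "Q \<in> {0, P, - P}"
proof -
  obtain y where y: "sp P y \<noteq> 0" using sp_nondegenerate[OF P(1)] .
  define c where "c = sp u v"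
  have c: "c = 1 \<or> c = -1" using uv F3_cases[of c] by (simp add: c_def)
  have vals: "sp u v = c" "sp v u = - c" "sp P u = 0" "sp P v = 0" "sp Q u = 0" "sp Q v = 0" "sp Q P = 0"
      "sp y u = - sp u y" "sp y v = - sp v y"
    using P Q PQ sp_swap[of v u] sp_swap[of P u] sp_swap[of P v] sp_swap[of Q u] sp_swap[of Q v]
      sp_swap[of Q P] sp_swap[of y u] sp_swap[of y v]
    by (simp_all add: c_def)
  \<comment> \<open>\<open>y\<close> is corrected along \<open>u\<close> and \<open>v\<close> to be
    orthogonal to both, which completes \<open>P\<close> to a hyperbolic pair.\<close>
  define R where "R = y + (c * sp v y) *s u - (c * sp u y) *s v"
  have R: "sp P R = sp P y" "sp u R = 0" "sp v R = 0"
    using c by (auto simp: R_def vals)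
  define k where "k = sp P R * sp Q R"
  have "Q = k *s P"
    using sp_basis_expansion[OF uv, of P R Q] y R P by (simp add: vals k_def)
  with F3_cases[of k] show ?thesis by auto
qed

section \<open>Blocks over a triangle\<close>

text \<open>Balancedness in terms of projections. Equivalently, \<open>u\<close> and
  \<open>v\<close> are non-orthogonal and \<open>u + v + w\<close> is orthogonal to both.\<close>

definition tri :: "F3 ^ 4 \<Rightarrow> F3 ^ 4 \<Rightarrow> F3 ^ 4 \<Rightarrow> bool" where
  "tri u v w \<longleftrightarrow> sp u v \<noteq> 0 \<and> sp v w = sp u v \<and> sp w u = sp u v"

lemma tri_rotate: "tri u v w \<Longrightarrow> tri v w u"
  by (auto simp: tri_def)

lemma tri_flip: "tri u v w \<Longrightarrow> tri v u w"
  unfolding tri_def using sp_swap[of u v] sp_swap[of v w] sp_swap[of w u] by simp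

lemma tri_sum_orth:
  assumes "tri u v w"
  shows "sp u (u + v + w) = 0" "sp v (u + v + w) = 0" "sp w (u + v + w) = 0"
  using assms sp_swap[of u v] sp_swap[of v w] sp_swap[of w u] by (simp_all add: tri_def)

lemma edge_of_triangle:
  fixes b :: "'i \<Rightarrow> F3 ^ 4"
  assumes "tri (b i) (b j) (b k)" "x \<in> {i, j, k}" "y \<in> {i, j, k}" "x \<noteq> y"
  obtains z where "{x, y, z} = {i, j, k}" "tri (b x) (b y) (b z)" "b x + b y + b z = b i + b j + b k"
proof -
  note t = assms(1) tri_flip[OF assms(1)]
  note t' = t t[THEN tri_rotate] t[THEN tri_rotate, THEN tri_rotate]
  have "x = i \<and> y = j \<or> x = i \<and> y = k \<or> x = j \<and> y = i \<or> x = j \<and> y = k \<or> x = k \<and> y = i \<or> x = k \<and> y = j"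
    using assms by blast
  then show thesis
    using t' that[of k] that[of j] that[of i] by (elim disjE) (simp_all add: insert_commute add_ac)
qed

text \<open>What remains of the list: \<open>Z\<close> holds the vector-zero blocks and
  \<open>b\<close> the projections. \<open>signed_count\<close> is supplied by the polynomial method
  and \<open>triangle\<close> by the No-full condition.\<close>

locale triangle_blocks =
  fixes I :: "'i set" and Z :: "'i set set" and b :: "'i \<Rightarrow> F3 ^ 4"
  assumes finite_I: "finite I"
    and Z_subset: "B \<in> Z \<Longrightarrow> B \<subseteq> I"
    and Z_union: "B \<in> Z \<Longrightarrow> C \<in> Z \<Longrightarrow> B \<inter> C = {} \<Longrightarrow> B \<union> C \<in> Z"
    and Z_sum: "B \<in> Z \<Longrightarrow> sum b B = 0"
    and b_nonzero: "i \<in> I \<Longrightarrow> b i \<noteq> 0"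
    and signed_count: "Y \<subseteq> I \<Longrightarrow> card Y \<le> 2 \<Longrightarrow> (\<Sum>B | B \<in> Z \<and> Y \<subseteq> B. (-1::F3) ^ card B) = 0"
    and triangle: "B \<in> Z \<Longrightarrow> i \<in> B \<Longrightarrow> j \<in> B \<Longrightarrow> sp (b i) (b j) \<noteq> 0 \<Longrightarrow>
      \<exists>k\<in>B. tri (b i) (b j) (b k) \<and> (\<forall>l\<in>B - {i, j, k}. \<forall>m\<in>B. sp (b l) (b m) = 0)"
begin

section \<open>Counts and the structure of single blocks\<close>

definition N :: "'i set \<Rightarrow> F3" where
  "N Y = (\<Sum>B | B \<in> Z \<and> Y \<subseteq> B. (-1) ^ card B)"

lemma finite_Z: "finite Z"
  using finite_I Z_subset by (meson Pow_iff finite_Pow_iff finite_subset subsetI)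

lemma N_eq: "N Y = (\<Sum>B\<in>Z. if Y \<subseteq> B then (-1) ^ card B else 0)"
  unfolding N_def by (rule sum.inter_filter[OF finite_Z, of "\<lambda>B. (-1) ^ card B" "\<lambda>B. Y \<subseteq> B"])

lemma N_nonzero: "N Y \<noteq> 0 \<Longrightarrow> \<exists>B\<in>Z. Y \<subseteq> B"
  unfolding N_def by (metis (mono_tags, lifting) empty_Collect_eq sum.empty)

lemma N_small: "Y \<subseteq> I \<Longrightarrow> card Y \<le> 2 \<Longrightarrow> N Y = 0"
  unfolding N_def by (rule signed_count)

text \<open>A block has at most one triangle and all its edges lie there, so two edges meeting in
  \<open>j\<close> span it.\<close>

lemma path:
  assumes B: "B \<in> Z" "i \<in> B" "j \<in> B" "k \<in> B" and "i \<noteq> k"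
    and "sp (b i) (b j) \<noteq> 0" "sp (b j) (b k) \<noteq> 0"
  shows "tri (b i) (b j) (b k)"
proof -
  obtain l where l: "l \<in> B" "tri (b i) (b j) (b l)" "\<forall>l\<in>B - {i, j, l}. \<forall>m\<in>B. sp (b l) (b m) = 0"
    using triangle[OF B(1-3)] assms by blast
  have "k \<noteq> j" using assms by auto
  moreover have "sp (b k) (b j) \<noteq> 0" using assms sp_swap[of "b k"] by simp
  ultimately have "k = l" using l(3) B \<open>i \<noteq> k\<close> by blast
  with l show ?thesis by simp
qed

text \<open>The union is again a block, so a crossing edge lies in its only triangle. Two vertices
  of that triangle share one of the blocks; their edge needs a third vertex inside this block, which
  gives a fourth non-isolated index in the union.\<close>

lemma orth_disjoint:
  assumes "B \<in> Z" "C \<in> Z" "B \<inter> C = {}" "i \<in> B" "j \<in> C"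
  shows "sp (b i) (b j) = 0"
proof -
  have aux: "sp (b i) (b j) = 0" if BC: "B \<in> Z" "C \<in> Z" "B \<inter> C = {}" "i \<in> B" "j \<in> C"
    and k: "k \<in> B" "tri (b i) (b j) (b k)"
      "\<forall>l\<in>(B \<union> C) - {i, j, k}. \<forall>m\<in>B \<union> C. sp (b l) (b m) = 0" for B C i j k
  proof (rule ccontr)
    assume "sp (b i) (b j) \<noteq> 0"
    then have "sp (b i) (b k) \<noteq> 0" using k(2) sp_swap[of "b i" "b k"] by (simp add: tri_def)
    then obtain l where l: "l \<in> B" "tri (b i) (b k) (b l)"
      using triangle[OF BC(1,4) k(1)] by blast
    then have "sp (b l) (b i) \<noteq> 0" "l \<noteq> i" "l \<noteq> k" by (auto simp: tri_def)
    moreover have "l \<noteq> j" using l BC by blast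
    ultimately show False using k(3) l(1) BC(4) by blast
  qed
  show ?thesis
  proof (rule ccontr)
    assume W: "sp (b i) (b j) \<noteq> 0"
    from assms obtain k where k: "k \<in> B \<union> C" "tri (b i) (b j) (b k)"
      "\<forall>l\<in>(B \<union> C) - {i, j, k}. \<forall>m\<in>B \<union> C. sp (b l) (b m) = 0"
      using triangle[OF Z_union[OF assms(1-3)], of i j] W by auto
    show False
    proof (cases "k \<in> B")
      case True
      with aux[OF assms True k(2,3)] W show False by simp
    next
      case False
      then have "k \<in> C" using k by simp
      moreover have "\<forall>l\<in>(C \<union> B) - {j, i, k}. \<forall>m\<in>C \<union> B. sp (b l) (b m) = 0"
        using k(3) by (simp add: Un_commute insert_commute)
      ultimately have "sp (b j) (b i) = 0"
        using aux[of C B j i k] assms tri_flip[OF k(2)] by (simp add: Int_commute)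
      with W sp_swap[of "b i"] show False by simp
    qed
  qed
qed

text \<open>Indices outside the triangle are isolated, so their nonzero projections are orthogonal
  to the triangle and hence multiples of \<open>P\<close>. At least one is needed to cancel the sum
  \<open>P\<close>.\<close>

lemma block_over_triangle:
  assumes B: "B \<in> Z" "i \<in> B" "j \<in> B" "k \<in> B" and t: "tri (b i) (b j) (b k)"
    and P: "P = b i + b j + b k" "P \<noteq> 0"
  shows "\<And>d m. d \<in> B - {i, j, k} \<Longrightarrow> m \<in> B \<Longrightarrow> sp (b d) (b m) = 0"
    and "\<And>d. d \<in> B - {i, j, k} \<Longrightarrow> b d \<in> {P, - P}"
    and "B - {i, j, k} \<noteq> {}"
proof -
  have W: "sp (b i) (b j) \<noteq> 0" using t by (simp add: tri_def)
  have dist: "i \<noteq> j" "j \<noteq> k" "i \<noteq> k" using t by (auto simp: tri_def)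
  obtain l where l: "l \<in> B" "tri (b i) (b j) (b l)" "\<forall>d\<in>B - {i, j, l}. \<forall>m\<in>B. sp (b d) (b m) = 0"
    using triangle[OF B(1-3) W] by blast
  have "sp (b k) (b i) \<noteq> 0" using t by (simp add: tri_def)
  then have "l = k" using l(3) B dist by blast
  then show orth: "sp (b d) (b m) = 0" if "d \<in> B - {i, j, k}" "m \<in> B" for d m
    using l(3) that by blast
  show "b d \<in> {P, - P}" if d: "d \<in> B - {i, j, k}" for d
  proof -
    have o: "sp (b i) (b d) = 0" "sp (b j) (b d) = 0" "sp (b k) (b d) = 0"
      using orth[OF d] B sp_swap[of _ "b d"] by simp_all
    then have "b d \<in> {0, P, - P}"
      using sp_parallel[OF W P(2), of "b d"] tri_sum_orth[OF t] by (simp add: P(1))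
    moreover have "b d \<noteq> 0" using d B(1) Z_subset b_nonzero by blast
    ultimately show ?thesis by blast
  qed
  show "B - {i, j, k} \<noteq> {}"
  proof
    assume "B - {i, j, k} = {}"
    then have "B = {i, j, k}" using B by blast
    then have "sum b B = P" using dist by (simp add: P(1) add.assoc)
    with Z_sum[OF B(1)] P(2) show False by simp
  qed
qed

text \<open>Two blocks through the edge \<open>i j\<close> whose isolated parts lie over non-orthogonal points
  exclude each other: every block that contains \<open>k\<close> but neither \<open>i\<close> nor \<open>j\<close>
  meets \<open>C - {i, j}\<close> in exactly one index, so \<open>x\<^sub>k (1 - x\<^sub>i - x\<^sub>j - (\<Sum>g\<in>C - {i, j}. x\<^sub>g))\<close>
  is a quadratic that detects the blocks containing \<open>{i, j, k}\<close>.\<close>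

lemma N_eq_0_of_two_points:
  assumes t: "tri (b i) (b j) (b k)" and t': "tri (b i) (b j) (b k')"
    and C: "C \<in> Z" "i \<in> C" "j \<in> C" "k' \<in> C" and k: "k \<in> I"
    and P: "P = b i + b j + b k" and P': "P' = b i + b j + b k'" and PP: "sp P P' \<noteq> 0"
  shows "N {i, j, k} = 0"
proof -
  define G where "G = C - {i, j}"
  define e where "e B = (-1::F3) ^ card B" for B :: "'i set"
  define c where "c = sp (b i) (b j)"
  have c: "c \<noteq> 0" "c \<noteq> - c" "- c \<noteq> c" "sp (b j) (b k) = c" "sp (b k) (b i) = c" "sp (b j) (b k') = c" "sp (b k') (b i) = c"
    using t t' F3_double[of c] by (auto simp: tri_def c_def eq_neg_iff_add_eq_0)
  have c': "sp (b j) (b i) = - c" "sp (b k) (b j) = - c" "sp (b i) (b k) = - c" "sp (b k') (b j) = - c" "sp (b i) (b k') = - c"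
    using c sp_swap c_def by metis+
  have P0: "P' \<noteq> 0" using PP by auto
  note str = block_over_triangle[OF C t' P' P0]
  have kk': "sp (b k) (b k') = sp P P'"
    using c c' by (simp add: P P' c_def[symmetric])
  have sk: "sp (b k) P' = sp P P'" using tri_sum_orth[OF t', folded P'] by (simp add: P)
  have G: "G = insert k' (C - {i, j, k'})" using C t' by (auto simp: G_def tri_def)
  have kG: "sp (b k) (b g) \<noteq> 0" if "g \<in> G" for g
  proof (cases "g = k'")
    case True then show ?thesis using kk' PP by simp
  next
    case False
    then have "b g = P' \<or> b g = - P'" using that str(2)[of g] by (auto simp: G_def)
    then show ?thesis using sk PP by (metis neg_equal_0_iff_equal sp_bilinear(6))
  qed
  have GG: "sp (b g) (b h) = 0" if "g \<in> G" "h \<in> G" for g h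
  proof (cases "g = k'")
    case True
    then show ?thesis using that str(1)[of h g] sp_swap[of "b g"] by (cases "h = k'") (auto simp: G_def)
  next
    case False then show ?thesis using that str(1)[of g h] by (auto simp: G_def)
  qed
  have finG: "finite G" unfolding G_def using finite_subset[OF Z_subset[OF C(1)] finite_I] by simp
  have kG': "k \<notin> G" using kG by fastforce
  have GI: "G \<subseteq> I" using C Z_subset by (auto simp: G_def)
  have iI: "i \<in> I" "j \<in> I" using C Z_subset by auto
  \<comment> \<open>Signs clash: \<open>b g\<close> pairs with \<open>b i\<close> to
    \<open>0\<close> or \<open>c\<close>, whereas a triangle through \<open>i\<close>,
    \<open>k\<close>, \<open>g\<close> would require \<open>- c\<close>. The same happens at
    \<open>j\<close> with signs reversed.\<close>
  have gi: "\<not> tri (b i) (b k) (b g)" "\<not> tri (b j) (b k) (b g)" if "g \<in> G" for g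
  proof -
    have "sp (b g) (b i) \<in> {0, c}" "sp (b g) (b j) \<in> {0, - c}"
      using that str(1)[of g] C c c' by (cases "g = k'"; auto simp: G_def)+
    then show "\<not> tri (b i) (b k) (b g)" "\<not> tri (b j) (b k) (b g)"
      using c c' by (auto simp: tri_def)
  qed
  \<comment> \<open>The quadratic evaluated on a block. It is \<open>1 - 1 - 1 = - 1\<close> if
    \<open>i\<close>, \<open>j\<close>, \<open>k\<close> all lie in it, and \<open>0\<close>
    otherwise.\<close>
  have pt: "(if {k} \<subseteq> B then e B else 0) - (if {i, k} \<subseteq> B then e B else 0) - (if {j, k} \<subseteq> B then e B else 0)
      - (\<Sum>g\<in>G. if {k, g} \<subseteq> B then e B else 0) = - (if {i, j, k} \<subseteq> B then e B else 0)" if B: "B \<in> Z" for B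
  proof (cases "k \<in> B")
    case False then show ?thesis by simp
  next
    case True
    have s: "(\<Sum>g\<in>G. if {k, g} \<subseteq> B then e B else 0) = (\<Sum>g\<in>G \<inter> B. e B)"
      using True by (subst sum.inter_restrict[OF finG]) simp
    show ?thesis
    proof (cases "i \<in> B \<or> j \<in> B")
      case True
      have "G \<inter> B = {}"
      proof (rule ccontr)
        assume "G \<inter> B \<noteq> {}"
        then obtain g where g: "g \<in> G" "g \<in> B" by blast
        then have "tri (b i) (b k) (b g) \<or> tri (b j) (b k) (b g)"
          using True path[OF B, of i k g] path[OF B, of j k g] \<open>k \<in> B\<close> c c' kG[OF g(1)]
          by (auto simp: G_def)
        with gi[OF g(1)] show False by blast
      qed
      then show ?thesis unfolding s using True \<open>k \<in> B\<close> by auto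
    next
      case False
      have "B \<inter> C \<noteq> {}"
        using orth_disjoint[OF B C(1) _ \<open>k \<in> B\<close> C(4)] kk' PP by auto
      then obtain g where g: "g \<in> G \<inter> B" using False by (auto simp: G_def)
      \<comment> \<open>Two such indices would both be joined to \<open>k\<close> and so form a
        triangle with it, but the indices of \<open>G\<close> are pairwise orthogonal.\<close>
      have "h = g" if h: "h \<in> G \<inter> B" for h
      proof (rule ccontr)
        assume "h \<noteq> g"
        then have "tri (b h) (b k) (b g)"
          using path[OF B, of h k g] g h \<open>k \<in> B\<close> kG[of g] kG[of h] sp_swap[of "b h" "b k"] by auto
        then show False using GG[of g h] g h by (simp add: tri_def)
      qed
      with g have "G \<inter> B = {g}" by blast
      then show ?thesis unfolding s using False \<open>k \<in> B\<close> by auto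
    qed
  qed
  have "- N {i, j, k} = (\<Sum>B\<in>Z. - (if {i, j, k} \<subseteq> B then e B else 0))"
    unfolding N_eq e_def sum_negf ..
  also have "\<dots> = (\<Sum>B\<in>Z. (if {k} \<subseteq> B then e B else 0) - (if {i, k} \<subseteq> B then e B else 0)
      - (if {j, k} \<subseteq> B then e B else 0) - (\<Sum>g\<in>G. if {k, g} \<subseteq> B then e B else 0))"
    by (rule sum.cong[OF refl]) (simp only: pt)
  also have "\<dots> = N {k} - N {i, k} - N {j, k} - (\<Sum>g\<in>G. N {k, g})"
    unfolding N_eq e_def sum_subtractf by (simp add: sum.swap[of _ G Z])
  also have "\<dots> = 0"
  proof -
    have "N {k, g} = 0" if "g \<in> G" for g
      by (rule N_small) (use that GI k in \<open>auto simp: card_insert_if\<close>)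
    moreover have "N {k} = 0" "N {i, k} = 0" "N {j, k} = 0"
      by (rule N_small; use k iI in \<open>auto simp: card_insert_if\<close>)+
    ultimately show ?thesis by simp
  qed
  finally show ?thesis by simp
qed

text \<open>Every block containing the edge contains exactly one index completing it to a triangle,
  so the sum collapses to \<open>N {i, j}\<close>.\<close>

lemma edge_sum:
  assumes ij: "i \<in> I" "j \<in> I" and W: "sp (b i) (b j) \<noteq> 0"
  shows "(\<Sum>k | k \<in> I \<and> tri (b i) (b j) (b k). N {i, j, k}) = 0"
proof -
  define e where "e B = (-1::F3) ^ card B" for B :: "'i set"
  let ?T = "{k \<in> I. tri (b i) (b j) (b k)}"
  have fin: "finite ?T" using finite_I by simp
  have pt: "(\<Sum>k\<in>?T. if {i, j, k} \<subseteq> B then e B else 0) = (if {i, j} \<subseteq> B then e B else 0)"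
    if B: "B \<in> Z" for B
  proof (cases "{i, j} \<subseteq> B")
    case False then show ?thesis by auto
  next
    case True
    then obtain l where l: "l \<in> B" "tri (b i) (b j) (b l)" "\<forall>d\<in>B - {i, j, l}. \<forall>m\<in>B. sp (b d) (b m) = 0"
      using triangle[OF B _ _ W] by blast
    have "k = l" if "k \<in> ?T \<inter> B" for k
    proof (rule ccontr)
      assume "k \<noteq> l"
      moreover have "k \<noteq> i" "k \<noteq> j" "sp (b k) (b i) \<noteq> 0" using that by (auto simp: tri_def)
      ultimately show False using l(3) that True by blast
    qed
    moreover have "l \<in> ?T \<inter> B" using l Z_subset[OF B] by blast
    ultimately have TB: "?T \<inter> B = {l}" by blast
    have "(\<Sum>k\<in>?T. if {i, j, k} \<subseteq> B then e B else 0) = (\<Sum>k\<in>?T \<inter> B. e B)"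
      using True by (subst sum.inter_restrict[OF fin]) simp
    with TB True show ?thesis by simp
  qed
  have "(\<Sum>k\<in>?T. N {i, j, k}) = (\<Sum>B\<in>Z. \<Sum>k\<in>?T. if {i, j, k} \<subseteq> B then e B else 0)"
    unfolding N_eq e_def by (rule sum.swap)
  also have "\<dots> = (\<Sum>B\<in>Z. if {i, j} \<subseteq> B then e B else 0)"
    by (rule sum.cong[OF refl]) (rule pt)
  also have "\<dots> = N {i, j}" unfolding N_eq e_def ..
  also have "\<dots> = 0" by (rule N_small) (use ij in \<open>auto simp: card_insert_if\<close>)
  finally show ?thesis .
qed

section \<open>Pairs of triangles with non-orthogonal points\<close>

text \<open>Disjoint triangles would lie in disjoint blocks, and an isolated index over
  \<open>P\<close> or \<open>- P\<close> would then be orthogonal to \<open>P'\<close>. A shared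
  edge is excluded by \<open>N_eq_0_of_two_points\<close>.\<close>

lemma live_triangles_share_one:
  assumes t: "tri (b i) (b j) (b k)" "{i, j, k} \<subseteq> I" and N: "N {i, j, k} \<noteq> 0"
    and t': "tri (b i') (b j') (b k')" "{i', j', k'} \<subseteq> I" and N': "N {i', j', k'} \<noteq> 0"
    and P: "P = b i + b j + b k" and P': "P' = b i' + b j' + b k'" and PP: "sp P P' \<noteq> 0"
  obtains x where "{i, j, k} \<inter> {i', j', k'} = {x}"
proof -
  obtain B where B: "B \<in> Z" "{i, j, k} \<subseteq> B" using N_nonzero[OF N] by blast
  obtain C where C: "C \<in> Z" "{i', j', k'} \<subseteq> C" using N_nonzero[OF N'] by blast
  have P0: "P \<noteq> 0" "P' \<noteq> 0" using PP by auto
  note strB = block_over_triangle[OF B(1) _ _ _ t(1) P P0(1)]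
  note strC = block_over_triangle[OF C(1) _ _ _ t'(1) P' P0(2)]
  have Borth: "sp P (b l) = 0" if "\<And>m. m \<in> {i, j, k} \<Longrightarrow> sp (b m) (b l) = 0" for l
    using that by (simp add: P)
  have Corth: "sp (b l) P' = 0" if "\<And>m. m \<in> {i', j', k'} \<Longrightarrow> sp (b l) (b m) = 0" for l
    using that by (simp add: P')
  have KP: "sp (b m) P = 0" if "m \<in> {i, j, k}" for m
    using tri_sum_orth[OF t(1)] that by (auto simp: P)
  have KP': "sp (b m) P' = 0" if "m \<in> {i', j', k'}" for m
    using tri_sum_orth[OF t'(1)] that by (auto simp: P')
  have D: "sp (b d) P' \<noteq> 0" if "d \<in> B - {i, j, k}" for d
    using strB(2)[OF _ _ _ that] B(2) PP by auto
  have D': "sp (b d) P \<noteq> 0" if "d \<in> C - {i', j', k'}" for d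
    using strC(2)[OF _ _ _ that] C(2) PP sp_swap[of P' P] by auto
  have ne: "{i, j, k} \<inter> {i', j', k'} \<noteq> {}"
  proof
    assume dis: "{i, j, k} \<inter> {i', j', k'} = {}"
    obtain d where d: "d \<in> B - {i, j, k}" using strB(3) B(2) by auto
    obtain d' where d': "d' \<in> C - {i', j', k'}" using strC(3) C(2) by auto
    have "B \<inter> C = {}"
    proof (rule ccontr)
      assume "B \<inter> C \<noteq> {}"
      then obtain x where x: "x \<in> B" "x \<in> C" by blast
      \<comment> \<open>A common index is orthogonal to \<open>P\<close> because it lies in
        \<open>B\<close>. This puts it into the second triangle, so it is orthogonal to
        \<open>P'\<close> and lies in the first as well.\<close>
      have "x \<in> {i', j', k'} \<or> sp (b x) P \<noteq> 0" "x \<in> {i, j, k} \<or> sp (b x) P' \<noteq> 0"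
        using x D D' by blast+
      moreover have "x \<in> {i, j, k} \<Longrightarrow> sp (b x) P = 0" "x \<in> {i', j', k'} \<Longrightarrow> sp (b x) P' = 0"
        using KP KP' by blast+
      moreover have "x \<notin> {i, j, k} \<Longrightarrow> sp (b x) P = 0"
        using strB(2)[of x] B(2) x by fastforce
      ultimately show False using dis by blast
    qed
    then have "sp (b d) (b m) = 0" if "m \<in> C" for m
      using orth_disjoint[OF B(1) C(1)] d that by blast
    then show False using Corth[of d] D[OF d] C(2) by blast
  qed
  then obtain x where x: "x \<in> {i, j, k}" "x \<in> {i', j', k'}" by blast
  have "y = x" if y: "y \<in> {i, j, k}" "y \<in> {i', j', k'}" for y
  proof (rule ccontr)
    assume "y \<noteq> x"
    then have xy: "x \<noteq> y" by simp
    obtain z where z: "{x, y, z} = {i, j, k}" "tri (b x) (b y) (b z)" "b x + b y + b z = P"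
      using edge_of_triangle[where b = b, OF t(1) x(1) y(1) xy] unfolding P by blast
    obtain z' where z': "{x, y, z'} = {i', j', k'}" "tri (b x) (b y) (b z')" "b x + b y + b z' = P'"
      using edge_of_triangle[where b = b, OF t'(1) x(2) y(2) xy] unfolding P' by blast
    have "z \<in> {i, j, k}" "z' \<in> {i', j', k'}" by (simp_all flip: z(1) z'(1))
    then have "z \<in> I" "x \<in> C" "y \<in> C" "z' \<in> C" using t(2) C(2) x(2) y(2) by auto
    then have "N {x, y, z} = 0"
      by (intro N_eq_0_of_two_points[OF z(2) z'(2) C(1) _ _ _ _ z(3)[symmetric] z'(3)[symmetric] PP])
    with z(1) N show False by simp
  qed
  with x that show thesis by blast
qed

text \<open>Since \<open>N {j, k} = 0\<close>, some block contains the edge \<open>j k\<close> but not \<open>i\<close>, and it has to meet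
  the block \<open>C\<close>. An index of \<open>C\<close> outside the triangle cannot lie in it because \<open>P\<close> and \<open>P'\<close> are not
  orthogonal, and no second triangle over \<open>j k\<close> is possible by \<open>N_eq_0_of_two_points\<close>.\<close>

lemma live_triangle_orth:
  assumes t: "tri (b i) (b j) (b k)" "{i, j, k} \<subseteq> I" and N: "N {i, j, k} \<noteq> 0"
    and t': "tri (b i) (b j') (b k')" and C: "C \<in> Z" "{i, j', k'} \<subseteq> C"
    and dis: "{j, k} \<inter> {j', k'} = {}"
    and P: "P = b i + b j + b k" and P': "P' = b i + b j' + b k'" and PP: "sp P P' \<noteq> 0"
  shows "\<exists>g\<in>{b j', b k'}. sp (b j) g = 0 \<and> sp (b k) g = 0"
proof -
  have "N {j, k} = 0" by (rule N_small) (use t in \<open>auto simp: card_insert_if\<close>)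
  have "\<exists>B\<in>Z. j \<in> B \<and> k \<in> B \<and> i \<notin> B"
  proof (rule ccontr)
    assume "\<not> ?thesis"
    then have "{B. B \<in> Z \<and> {i, j, k} \<subseteq> B} = {B. B \<in> Z \<and> {j, k} \<subseteq> B}" by blast
    then have "N {i, j, k} = N {j, k}" by (simp only: N_def)
    with N \<open>N {j, k} = 0\<close> show False by simp
  qed
  then obtain B where B: "B \<in> Z" "j \<in> B" "k \<in> B" "i \<notin> B" by blast
  have P0: "P \<noteq> 0" "P' \<noteq> 0" using PP by auto
  note strC = block_over_triangle[OF C(1) _ _ _ t' P' P0(2)]
  have W: "sp (b j) (b k) \<noteq> 0" "sp (b i) (b j) \<noteq> 0" "sp (b k) (b i) \<noteq> 0" using t by (auto simp: tri_def)
  have outer: "\<not> (sp (b j) (b d) = 0 \<and> sp (b k) (b d) = 0)" "\<not> tri (b j) (b k) (b d)" "d \<noteq> j" "d \<noteq> k"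
    if d: "d \<in> C - {i, j', k'}" for d
  proof -
    have bd: "b d = P' \<or> b d = - P'" "sp (b d) (b i) = 0"
      using strC(1)[OF _ _ _ d, of i] strC(2)[OF _ _ _ d] C(2) by auto
    have "sp P (b d) \<noteq> 0" using bd PP by auto
    \<comment> \<open>\<open>b d\<close> is orthogonal to \<open>b i\<close>, so its pairing with
      \<open>P\<close> comes from \<open>b j\<close> and \<open>b k\<close> only. In a triangle over
      \<open>j k\<close> these two contributions would cancel.\<close>
    then have s: "sp (b j) (b d) + sp (b k) (b d) \<noteq> 0"
      using bd(2) sp_swap[of "b i" "b d"] by (simp add: P)
    then show "\<not> (sp (b j) (b d) = 0 \<and> sp (b k) (b d) = 0)" "\<not> tri (b j) (b k) (b d)"
      using sp_swap[of "b j" "b d"] by (auto simp: tri_def)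
    show "d \<noteq> j" "d \<noteq> k" using bd(2) W sp_swap[of "b i" "b j"] by auto
  qed
  have "B \<inter> C \<noteq> {}"
  proof
    assume BC: "B \<inter> C = {}"
    obtain d where d: "d \<in> C - {i, j', k'}" using strC(3) C(2) by auto
    then have "sp (b j) (b d) = 0" "sp (b k) (b d) = 0"
      using orth_disjoint[OF B(1) C(1) BC] B by auto
    with outer[OF d] show False by blast
  qed
  then obtain g where g: "g \<in> B" "g \<in> C" by blast
  have gjk: "g \<noteq> j" "g \<noteq> k" using g B(4) dis outer(3,4)[of g] by blast+
  obtain l where l: "l \<in> B" "tri (b j) (b k) (b l)" "\<forall>d\<in>B - {j, k, l}. \<forall>m\<in>B. sp (b d) (b m) = 0"
    using triangle[OF B(1-3) W(1)] by blast
  show ?thesis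
  proof (cases "g = l")
    case False
    then have "sp (b g) (b j) = 0" "sp (b g) (b k) = 0" using l(3) g gjk B by blast+
    then have *: "sp (b j) (b g) = 0" "sp (b k) (b g) = 0" using sp_swap[of "b j"] sp_swap[of "b k"] by auto
    with outer(1)[of g] g B(4) have "g = j' \<or> g = k'" by blast
    with * show ?thesis by blast
  next
    case True
    then have tg: "tri (b j) (b k) (b g)" using l by simp
    with outer(2)[of g] g B(4) have "g = j' \<or> g = k'" by blast
    then have ig: "sp (b i) (b g) \<noteq> 0" using t' sp_swap[of "b i" "b k'"] by (auto simp: tri_def)
    \<comment> \<open>The point of the second triangle over \<open>j k\<close>. Unlike
      \<open>P\<close>, it is not orthogonal to \<open>b i\<close>, so it is no multiple of
      \<open>P\<close> and hence not orthogonal to \<open>P\<close>.\<close>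
    define Q where "Q = b j + b k + b g"
    have tj: "tri (b j) (b k) (b i)" using t(1) by (rule tri_rotate)
    have P2: "P = b j + b k + b i" by (simp add: P add_ac)
    have "sp (b i) Q \<noteq> 0"
      using ig t(1) sp_swap[of "b i" "b k"] by (simp add: Q_def tri_def)
    moreover have "sp (b i) P = 0" using tri_sum_orth[OF t(1)] by (simp add: P)
    ultimately have "Q \<notin> {0, P, - P}" by auto
    then have "sp P Q \<noteq> 0"
      using sp_parallel[OF W(1) P0(1), of Q] tri_sum_orth[OF tj, folded P2] tri_sum_orth[OF tg, folded Q_def]
      by blast
    then have "N {j, k, i} = 0"
      using N_eq_0_of_two_points[OF tj tg B(1-3) g(1) _ P2 Q_def] t by blast
    with N show ?thesis by (simp add: insert_commute)
  qed
qed

section \<open>Triangles of projections and their weights\<close>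

definition fiber :: "F3 ^ 4 \<Rightarrow> 'i set" where
  "fiber u = {i \<in> I. b i = u}"

definition weight :: "F3 ^ 4 \<Rightarrow> F3 ^ 4 \<Rightarrow> F3 ^ 4 \<Rightarrow> F3" where
  "weight u v w = (\<Sum>i\<in>fiber u. \<Sum>j\<in>fiber v. \<Sum>k\<in>fiber w. N {i, j, k})"

text \<open>For triangles this is weaker than nonzero \<open>weight\<close>, since terms may cancel.
  Orthogonality arguments use single index triples and need only \<open>live\<close>; cancellation
  arguments use \<open>weight\<close>.\<close>

definition live :: "F3 ^ 4 \<Rightarrow> F3 ^ 4 \<Rightarrow> F3 ^ 4 \<Rightarrow> bool" where
  "live u v w \<longleftrightarrow> tri u v w \<and> (\<exists>i\<in>fiber u. \<exists>j\<in>fiber v. \<exists>k\<in>fiber w. N {i, j, k} \<noteq> 0)"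

lemma finite_fiber: "finite (fiber u)"
  using finite_I by (simp add: fiber_def)

lemma weight_flip: "weight v u w = weight u v w"
  unfolding weight_def by (subst sum.swap, intro sum.cong refl arg_cong[where f = N]) blast

lemma weight_rotate: "weight v w u = weight u v w"
proof -
  have "weight v w u = (\<Sum>j\<in>fiber v. \<Sum>i\<in>fiber u. \<Sum>k\<in>fiber w. N {j, k, i})"
    unfolding weight_def by (rule sum.cong[OF refl], rule sum.swap)
  also have "\<dots> = (\<Sum>i\<in>fiber u. \<Sum>j\<in>fiber v. \<Sum>k\<in>fiber w. N {j, k, i})"
    by (rule sum.swap)
  also have "\<dots> = weight u v w"
    unfolding weight_def by (intro sum.cong refl arg_cong[where f = N]) blast
  finally show ?thesis .
qed

lemma live_tri: "live u v w \<Longrightarrow> tri u v w"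
  by (simp add: live_def)

lemma liveI:
  "tri u v w \<Longrightarrow> i \<in> fiber u \<Longrightarrow> j \<in> fiber v \<Longrightarrow> k \<in> fiber w \<Longrightarrow> N {i, j, k} \<noteq> 0 \<Longrightarrow> live u v w"
  unfolding live_def by blast

lemma liveE:
  assumes "live u v w"
  obtains i j k where "i \<in> fiber u" "j \<in> fiber v" "k \<in> fiber w" "N {i, j, k} \<noteq> 0"
  using assms unfolding live_def by blast

lemma live_rotate: assumes "live u v w" shows "live v w u"
proof -
  obtain i j k where *: "i \<in> fiber u" "j \<in> fiber v" "k \<in> fiber w" "N {i, j, k} \<noteq> 0"
    using assms by (rule liveE)
  moreover have "{j, k, i} = {i, j, k}" by auto
  ultimately show ?thesis using liveI[OF tri_rotate[OF live_tri[OF assms]], of j k i] by simp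
qed

lemma live_flip: assumes "live u v w" shows "live v u w"
proof -
  obtain i j k where *: "i \<in> fiber u" "j \<in> fiber v" "k \<in> fiber w" "N {i, j, k} \<noteq> 0"
    using assms by (rule liveE)
  moreover have "{j, i, k} = {i, j, k}" by auto
  ultimately show ?thesis using liveI[OF tri_flip[OF live_tri[OF assms]], of j i k] by simp
qed

lemma weight_nonzero_live:
  assumes "weight u v w \<noteq> 0" "tri u v w" shows "live u v w"
proof (rule ccontr)
  assume "\<not> live u v w"
  then have "N {i, j, k} = 0" if "i \<in> fiber u" "j \<in> fiber v" "k \<in> fiber w" for i j k
    using liveI[OF assms(2) that] by blast
  then have "weight u v w = 0" unfolding weight_def by (intro sum.neutral ballI)
  with assms show False by simp
qed

text \<open>This is \<open>edge_sum\<close> with the completing indices grouped by their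
  projection.\<close>

lemma weight_edge_sum:
  assumes uv: "sp u v \<noteq> 0"
  shows "(\<Sum>w | tri u v w. weight u v w) = 0"
proof -
  have "(\<Sum>w | tri u v w. weight u v w) =
      (\<Sum>i\<in>fiber u. \<Sum>w | tri u v w. \<Sum>j\<in>fiber v. \<Sum>k\<in>fiber w. N {i, j, k})"
    unfolding weight_def by (rule sum.swap)
  also have "\<dots> = (\<Sum>i\<in>fiber u. \<Sum>j\<in>fiber v. \<Sum>w | tri u v w. \<Sum>k\<in>fiber w. N {i, j, k})"
    by (rule sum.cong[OF refl], rule sum.swap)
  also have "\<dots> = (\<Sum>i\<in>fiber u. \<Sum>j\<in>fiber v. \<Sum>k | k \<in> I \<and> tri (b i) (b j) (b k). N {i, j, k})"
  proof (intro sum.cong[OF refl])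
    fix i j assume ij: "i \<in> fiber u" "j \<in> fiber v"
    have "(\<Sum>w | tri u v w. \<Sum>k\<in>fiber w. N {i, j, k}) = (\<Sum>k\<in>(\<Union>w\<in>{w. tri u v w}. fiber w). N {i, j, k})"
      by (rule sum.UNION_disjoint[symmetric]) (simp_all add: finite_fiber, auto simp: fiber_def)
    also have "(\<Union>w\<in>{w. tri u v w}. fiber w) = {k. k \<in> I \<and> tri (b i) (b j) (b k)}"
      using ij by (auto simp: fiber_def)
    finally show "(\<Sum>w | tri u v w. \<Sum>k\<in>fiber w. N {i, j, k}) =
        (\<Sum>k | k \<in> I \<and> tri (b i) (b j) (b k). N {i, j, k})" .
  qed
  also have "\<dots> = 0"
    by (intro sum.neutral ballI edge_sum) (use uv in \<open>auto simp: fiber_def\<close>)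
  finally show ?thesis .
qed

text \<open>The index shared by the two realising triples supplies the common vector
  \<open>x\<close>; after rotating it to the front \<open>live_triangle_orth\<close>
  applies.\<close>

lemma live_orth:
  assumes L: "live u v w" and L': "live u' v' w'"
    and P: "P = u + v + w" and P': "P' = u' + v' + w'" and PP: "sp P P' \<noteq> 0"
  obtains x p q p' q' where "(x, p, q) \<in> {(u, v, w), (v, w, u), (w, u, v)}"
    "(x, p', q') \<in> {(u', v', w'), (v', w', u'), (w', u', v')}" "\<exists>g\<in>{p', q'}. sp p g = 0 \<and> sp q g = 0"
proof -
  obtain i j k where ijk: "i \<in> I" "j \<in> I" "k \<in> I" "b i = u" "b j = v" "b k = w" "N {i, j, k} \<noteq> 0"
    using L by (auto simp: live_def fiber_def)
  obtain i' j' k' where ijk': "i' \<in> I" "j' \<in> I" "k' \<in> I" "b i' = u'" "b j' = v'" "b k' = w'" "N {i', j', k'} \<noteq> 0"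
    using L' by (auto simp: live_def fiber_def)
  have t: "tri (b i) (b j) (b k)" "tri (b i') (b j') (b k')"
    using L L' ijk ijk' by (simp_all add: live_def)
  have Pb: "P = b i + b j + b k" "P' = b i' + b j' + b k'" using ijk ijk' P P' by simp_all
  obtain x where x: "{i, j, k} \<inter> {i', j', k'} = {x}"
    using live_triangles_share_one[OF t(1) _ ijk(7) t(2) _ ijk'(7) Pb PP] ijk ijk' by auto
  obtain p q where p: "(x, p, q) \<in> {(i, j, k), (j, k, i), (k, i, j)}" using x by blast
  obtain p' q' where p': "(x, p', q') \<in> {(i', j', k'), (j', k', i'), (k', i', j')}" using x by blast
  have tp: "tri (b x) (b p) (b q)" "{x, p, q} = {i, j, k}" "P = b x + b p + b q"
    using p t(1) tri_rotate[OF t(1)] tri_rotate[OF tri_rotate[OF t(1)]] by (auto simp: Pb(1) add_ac)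
  have tp': "tri (b x) (b p') (b q')" "{x, p', q'} = {i', j', k'}" "P' = b x + b p' + b q'"
    using p' t(2) tri_rotate[OF t(2)] tri_rotate[OF tri_rotate[OF t(2)]] by (auto simp: Pb(2) add_ac)
  obtain C where C: "C \<in> Z" "{x, p', q'} \<subseteq> C" using N_nonzero[OF ijk'(7)] tp'(2) by auto
  have "p \<noteq> x" "q \<noteq> x" using tp(1) by (auto simp: tri_def)
  then have dis: "{p, q} \<inter> {p', q'} = {}" using x tp(2) tp'(2) by blast
  have "\<exists>g\<in>{b p', b q'}. sp (b p) g = 0 \<and> sp (b q) g = 0"
    by (rule live_triangle_orth[OF tp(1) _ _ tp'(1) C dis tp(3) tp'(3) PP])
      (use ijk tp(2) in auto)
  moreover have "(b x, b p, b q) \<in> {(u, v, w), (v, w, u), (w, u, v)}" using p ijk by auto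
  moreover have "(b x, b p', b q') \<in> {(u', v', w'), (v', w', u'), (w', u', v')}" using p' ijk' by auto
  ultimately show thesis using that by blast
qed

text \<open>Pairing with \<open>x\<close> gives \<open>0\<close> on \<open>x\<close>,
  \<open>d\<close> on \<open>j\<close> and \<open>j'\<close>, and \<open>- d\<close> on
  \<open>k\<close> and \<open>k'\<close>. Hence only \<open>x\<close> can be the shared vertex in
  \<open>live_orth\<close>.\<close>

lemma live_orth_apex:
  assumes L: "live x j k" and L': "live x j' k'" and c: "sp x j = sp x j'" and ne: "j \<noteq> j'" "k \<noteq> k'"
    and P: "P = x + j + k" and P': "P' = x + j' + k'" and PP: "sp P P' \<noteq> 0"
  shows "\<exists>g\<in>{j', k'}. sp j g = 0 \<and> sp k g = 0"
proof -
  define d where "d = sp x j"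
  have v: "sp x j = d" "sp x j' = d" "sp x k = - d" "sp x k' = - d" "sp x x = 0" "d \<noteq> 0" "d \<noteq> - d"
    using live_tri[OF L] live_tri[OF L'] c sp_swap[of x k] sp_swap[of x k'] F3_cases[of d]
    by (auto simp: tri_def d_def)
  have neI: "y \<noteq> y'" if "sp x y \<noteq> sp x y'" for y y' using that by auto
  have ne': "x \<noteq> j" "x \<noteq> k" "x \<noteq> j'" "x \<noteq> k'" "j \<noteq> k'" "k \<noteq> j'"
    by (rule neI; use v in auto)+
  obtain a p q p' q' where o: "(a, p, q) \<in> {(x, j, k), (j, k, x), (k, x, j)}"
      "(a, p', q') \<in> {(x, j', k'), (j', k', x), (k', x, j')}" "\<exists>g\<in>{p', q'}. sp p g = 0 \<and> sp q g = 0"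
    using live_orth[OF L L' P P' PP] .
  then have "p = j \<and> q = k \<and> p' = j' \<and> q' = k'" using ne ne' by auto
  with o(3) show ?thesis by simp
qed

section \<open>The isotropic point of an edge\<close>

lemma live_sum_orth:
  assumes "live u v w" "P = u + v + w"
  shows "sp u P = 0" "sp v P = 0" "sp w P = 0"
  using tri_sum_orth[OF live_tri[OF assms(1)]] unfolding assms(2) .

lemma tri_swap: "tri u v w \<Longrightarrow> tri u w v"
  by (meson tri_flip tri_rotate)

lemma live_swap: "live u v w \<Longrightarrow> live u w v"
  by (blast intro: live_flip live_rotate)

lemma weight_swap: "weight u w v = weight u v w"
  by (metis weight_flip weight_rotate)

lemma weight_edge_two:
  assumes uv: "sp u v \<noteq> 0" and w: "tri u v w" "tri u v w'" "w \<noteq> w'"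
    and other: "\<And>q. live u v q \<Longrightarrow> q \<noteq> w \<Longrightarrow> q \<noteq> w' \<Longrightarrow> False"
  shows "weight u v w' = - weight u v w"
proof -
  have "0 = (\<Sum>q | tri u v q. weight u v q)" using weight_edge_sum[OF uv] by simp
  also have "\<dots> = (\<Sum>q\<in>{w, w'}. weight u v q)"
    by (rule sum.mono_neutral_right) (use w other weight_nonzero_live in auto)
  also have "\<dots> = weight u v w + weight u v w'" using w(3) by simp
  finally show ?thesis by (simp add: eq_neg_iff_add_eq_0 add.commute)
qed

text \<open>Orthogonal points are parallel by \<open>sp_parallel\<close>. Otherwise
  \<open>live_orth\<close> applies with shared vertex \<open>x\<close> or \<open>y\<close>; the
  other end of the edge belongs to both triangles, and its pairings rule out both choices of
  \<open>g\<close>.\<close>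

lemma unique_point:
  assumes L: "live x y w" and L': "live x y w'"
    and P: "P = x + y + w" "P \<noteq> 0" and P': "P' = x + y + w'" "P' \<noteq> 0"
  shows "P' \<in> {P, - P}"
proof (cases "sp P P' = 0")
  case True
  have "sp x y \<noteq> 0" using live_tri[OF L] by (simp add: tri_def)
  then have "P' \<in> {0, P, - P}"
    using sp_parallel[of x y P P'] True P live_sum_orth[OF L P(1)] live_sum_orth[OF L' P'(1)] by blast
  with P' show ?thesis by simp
next
  case False
  have v: "sp x y \<noteq> 0" "sp y w = sp x y" "sp w x = sp x y" "sp y w' = sp x y" "sp w' x = sp x y"
    using live_tri[OF L] live_tri[OF L'] by (simp_all add: tri_def)
  have v': "sp y x = - sp x y" "sp w y = - sp x y" "sp x w = - sp x y" "sp w' y = - sp x y" "sp x w' = - sp x y"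
    using v sp_swap[of y x] sp_swap[of w y] sp_swap[of x w] sp_swap[of w' y] sp_swap[of x w']
    by simp_all
  have ne: "w \<noteq> w'"
  proof
    assume "w = w'"
    then have "P = P'" using P(1) P'(1) by simp
    with False show False by simp
  qed
  have neI: "a \<noteq> a'" if "sp x a \<noteq> sp x a'" for a a' using that by auto
  have ne': "x \<noteq> y" "x \<noteq> w" "x \<noteq> w'" "y \<noteq> w" "y \<noteq> w'"
    by (rule neI; use v v' F3_cases[of "sp x y"] in auto)+
  obtain a p q p' q' where o: "(a, p, q) \<in> {(x, y, w), (y, w, x), (w, x, y)}"
      "(a, p', q') \<in> {(x, y, w'), (y, w', x), (w', x, y)}" "\<exists>g\<in>{p', q'}. sp p g = 0 \<and> sp q g = 0"
    using live_orth[OF L L' P(1) P'(1) False] .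
  then have "p = y \<and> q = w \<and> p' = y \<and> q' = w' \<or> p = w \<and> q = x \<and> p' = w' \<and> q' = x"
    using ne ne' by auto
  with o(3) show ?thesis using v v' by auto
qed

text \<open>A \<^emph>\<open>bend\<close> is a triangle \<open>x, y, z = - x - y\<close> whose edges \<open>x y\<close> and \<open>x z\<close> have
  non-orthogonal points \<open>P\<close> and \<open>P'\<close>. Cancelling weights along the edges \<open>x y\<close>, then \<open>x (z + P)\<close>, then
  \<open>x (y - P)\<close> shows that a bend of nonzero weight has a further live triangle; its mirror image, obtained by
  exchanging \<open>y, P\<close> with \<open>z, P'\<close>, is live as well, and these two are incompatible (\<open>no_bend\<close>).\<close>

lemma bend_pairing:
  assumes L: "live x y (P - x - y)" and L': "live x (y + P') (- x - y)" and PP: "sp P P' \<noteq> 0"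
  shows "sp P P' = sp x y"
proof -
  have P: "P = x + y + (P - x - y)" and P': "P' = x + (y + P') + (- x - y)" by simp_all
  have o: "sp x P = 0" "sp y P = 0" "sp x P' = 0" "sp y P' = 0"
    using live_sum_orth[OF L P] live_sum_orth[OF L' P'] by simp_all
  have "sp x y \<noteq> 0" using live_tri[OF L] by (simp add: tri_def)
  have ne: "P \<noteq> 0" "P' \<noteq> 0" using PP by auto
  have "\<exists>g\<in>{y + P', - x - y}. sp y g = 0 \<and> sp (P - x - y) g = 0"
    by (rule live_orth_apex[OF L L' _ _ _ P P' PP]) (use o ne in simp_all)
  \<comment> \<open>The choice \<open>g = - x - y\<close> fails because
    \<open>sp y g = sp x y\<close>; the choice \<open>g = y + P'\<close> gives the claimed
    equality.\<close>
  then show ?thesis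
    using o \<open>sp x y \<noteq> 0\<close> sp_swap[of y x] sp_swap[of P y] by auto
qed

lemma bend_forces_triangle:
  assumes L: "live x y (P - x - y)" and L': "live x (y + P') (- x - y)" and PP: "sp P P' \<noteq> 0"
    and t: "weight x y (- x - y) \<noteq> 0"
  shows "live x (y - P) (P - P' - y)"
proof -
  define c where "c = sp x y"
  define z where "z = - x - y"
  have P: "P = x + y + (P - x - y)" and P': "P' = x + (y + P') + (- x - y)" by simp_all
  have c: "c \<noteq> 0" "c * c = 1" "sp x y = c"
    using live_tri[OF L] F3_square[of c] by (simp_all add: tri_def c_def)
  have PP': "sp P P' = c" using bend_pairing[OF L L' PP] by (simp add: c_def)
  have o: "sp x P = 0" "sp y P = 0" "sp x P' = 0" "sp y P' = 0"
    using live_sum_orth[OF L P] live_sum_orth[OF L' P'] by simp_all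
  have o': "sp P x = 0" "sp P y = 0" "sp P' x = 0" "sp P' y = 0" "sp y x = - c" "sp P' P = - c"
    using o c PP' sp_swap[of P x] sp_swap[of P y] sp_swap[of P' x] sp_swap[of P' y] sp_swap[of y x] sp_swap[of P' P]
    by simp_all
  note vals = c(3) PP' o o'
  have z: "sp x z = - c" "sp z x = c" "sp y z = c" "sp z y = - c" "sp z P = 0" "sp P z = 0" "sp z P' = 0" "sp P' z = 0"
    by (simp_all add: z_def vals)
  note vals = vals z
  have ne: "P \<noteq> 0" "P' \<noteq> 0" using PP by auto
  have Lz: "live x y (z + P)" using L by (simp add: z_def algebra_simps)
  have L'z: "live x (y + P') z" using L' by (simp add: z_def)
  have tri_z: "tri x y z" using c by (simp add: tri_def vals)
  \<comment> \<open>Comparison with the triangle \<open>x\<close>, \<open>y + P'\<close>,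
    \<open>z\<close> at the apex \<open>x\<close>: the two candidates for \<open>g\<close> pair with
    \<open>y + s *s P\<close> to \<open>s * c\<close> and \<open>c\<close>, both nonzero.\<close>
  have off: False if K: "live x (y + s *s P) w" and s: "s \<noteq> 0"
    and Q: "Q = x + (y + s *s P) + w" "sp Q P' \<noteq> 0" and wz: "w \<noteq> z" for s w Q
  proof -
    have "y + s *s P \<noteq> y + P'"
    proof
      assume "y + s *s P = y + P'"
      then have "P' = s *s P" by simp
      then have "sp P P' = 0" by simp
      with PP show False by simp
    qed
    then have "\<exists>g\<in>{y + P', z}. sp (y + s *s P) g = 0 \<and> sp w g = 0"
      by (intro live_orth_apex[OF K L'z _ _ wz Q(1) _ Q(2)]) (simp_all add: vals z_def)
    then show False using s c by (simp add: vals)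
  qed
  have dbl: "P + P = - P" by (rule F3_vector_double)
  have nc: "- c \<noteq> c" "c \<noteq> - c" using c F3_cases[of c] by auto
  \<comment> \<open>The only possible points over \<open>x y\<close> are \<open>0\<close>,
    \<open>P\<close> and \<open>- P\<close>. The last is impossible, since
    \<open>bend_pairing\<close> would give it the pairing \<open>c\<close> with \<open>P'\<close>
    instead of \<open>- c\<close>.\<close>
  have t1: "weight x y (z + P) = - weight x y z"
  proof (rule weight_edge_two)
    show "sp x y \<noteq> 0" "tri x y z" "tri x y (z + P)" "z \<noteq> z + P"
      using c ne tri_z by (simp_all add: tri_def vals)
    fix w assume w: "live x y w" "w \<noteq> z" "w \<noteq> z + P"
    define Q where "Q = x + y + w"
    have wQ: "w = Q - x - y" "w = z + Q" by (simp_all add: Q_def z_def)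
    have "Q \<noteq> 0" using w(2) wQ(2) by auto
    then have "Q \<in> {P, - P}"
      by (intro unique_point[OF L w(1) P ne(1) Q_def])
    then have "Q = - P" using w(3) wQ(2) by auto
    moreover have "sp Q P' = sp x y" if "sp Q P' \<noteq> 0"
      by (rule bend_pairing[OF _ L' that]) (use w(1) wQ(1) in simp)
    ultimately show False using vals c nc by auto
  qed
  have yzP: "tri x (z + P) y" "tri x (z + P) (y - P)"
    using c by (simp_all add: tri_def vals)
  have Lsw: "live x (z + P) y" using live_swap[OF Lz] .
  \<comment> \<open>Here the point \<open>- P\<close> would belong to the third vertex
    \<open>y + P\<close>, which \<open>off\<close> excludes.\<close>
  have t2: "weight x (z + P) (y - P) = - weight x (z + P) y"
  proof (rule weight_edge_two)
    show "sp x (z + P) \<noteq> 0" "tri x (z + P) y" "tri x (z + P) (y - P)" "y \<noteq> y - P"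
      using yzP c ne by (simp_all add: vals)
    fix w assume w: "live x (z + P) w" "w \<noteq> y" "w \<noteq> y - P"
    define Q where "Q = x + (z + P) + w"
    have wQ: "w = y - P + Q" by (simp add: Q_def z_def)
    have "Q \<noteq> 0" using w(3) wQ by auto
    then have "Q \<in> {P, - P}"
      by (intro unique_point[OF Lsw w(1) _ ne(1) Q_def]) (simp_all add: z_def)
    then have "Q = - P" using w(2) wQ by auto
    then have "w = y + 1 *s P" using wQ dbl by (simp add: algebra_simps)
    then have "live x (y + 1 *s P) (z + P)" using live_swap[OF w(1)] by simp
    moreover have "sp (x + (y + 1 *s P) + (z + P)) P' = - c"
      by (simp only: sp_bilinear vals) (simp add: F3_double)
    then have "sp (x + (y + 1 *s P) + (z + P)) P' \<noteq> 0" using c by simp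
    moreover have "z + P \<noteq> z" using ne by simp
    ultimately show False using off[OF _ one_neq_zero refl] by blast
  qed
  have t3: "weight x (y - P) (z + P) \<noteq> 0"
    using t[folded z_def] t1 t2 weight_swap[of x "y - P" "z + P"] weight_swap[of x y "z + P"] by simp
  \<comment> \<open>A single nonzero weight cannot sum to zero over the edge, so another live
    triangle exists. Its point \<open>R\<close> is then determined from its pairings with
    \<open>x\<close>, \<open>y\<close>, \<open>P\<close> and \<open>P'\<close>.\<close>
  have "\<exists>w. live x (y - P) w \<and> w \<noteq> z + P"
  proof (rule ccontr)
    assume none: "\<not> ?thesis"
    have "(\<Sum>q | tri x (y - P) q. weight x (y - P) q) = (\<Sum>q\<in>{z + P}. weight x (y - P) q)"
      by (rule sum.mono_neutral_right)
        (use none weight_nonzero_live tri_swap[OF yzP(2)] in auto)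
    then show False using weight_edge_sum[of x "y - P"] t3 c by (simp add: vals)
  qed
  then obtain w where w: "live x (y - P) w" "w \<noteq> z + P" by blast
  define R where "R = x + (y - P) + w"
  have wR: "w = z + P + R" by (simp add: R_def z_def)
  have R0: "R \<noteq> 0" using w(2) wR by auto
  have RP: "R \<noteq> P"
  proof
    assume "R = P"
    then have "w \<noteq> z" using wR dbl ne by (simp add: add.assoc)
    moreover have "live x (y + (- 1) *s P) w" "R = x + (y + (- 1) *s P) + w"
      using w(1) by (simp_all add: R_def)
    ultimately show False using off[of "- 1" w R] PP \<open>R = P\<close> by simp
  qed
  have RmP: "R \<noteq> - P"
  proof
    assume "R = - P"
    then have "live x z (y - P)" using live_swap[OF w(1)] wR by simp
    from unique_point[OF this live_swap[OF L'z], of "- P" P'] ne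
    have "P' \<in> {- P, P}" by (simp add: z_def)
    then show False using PP by auto
  qed
  have Ro: "sp x R = 0" "sp (y - P) R = 0"
    using live_sum_orth[OF w(1) R_def] by simp_all
  have "sp P R \<noteq> 0"
  proof
    assume "sp P R = 0"
    moreover have "sp x (y - P) \<noteq> 0" "sp (y - P) P = 0" using c by (simp_all add: vals)
    ultimately have "R \<in> {0, P, - P}" using sp_parallel[of x "y - P" P R] ne Ro o by blast
    with R0 RP RmP show False by blast
  qed
  then have "sp R P \<noteq> 0" using sp_swap[of R P] by simp
  moreover have "live x (y - P) (R - x - (y - P))"
    using w(1) by (simp add: R_def)
  moreover have "live x (y - P + P) (- x - (y - P))"
    using Lz by (simp add: z_def algebra_simps)
  \<comment> \<open>The edge \<open>x (y - P)\<close> with the points \<open>R\<close> and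
    \<open>P\<close> is another bend configuration.\<close>
  ultimately have "sp R P = sp x (y - P)" by (intro bend_pairing)
  then have RP': "sp R P = c" by (simp add: vals)
  have "sp R y = sp R P" using Ro(2) sp_swap[of R "y - P"] by simp
  then have Ry: "sp R y = c" "sp R x = 0" using RP' Ro sp_swap[of R x] by simp_all
  have RQ: "sp R P' = 0"
  proof (rule ccontr)
    assume "sp R P' \<noteq> 0"
    moreover have "live x (y + (- 1) *s P) w" "R = x + (y + (- 1) *s P) + w"
      using w(1) by (simp_all add: R_def)
    moreover have "w \<noteq> z"
    proof
      assume "w = z"
      then have "P + R = 0" using wR by (simp add: add.assoc)
      then show False using RmP by (simp add: eq_neg_iff_add_eq_0 add.commute)
    qed
    ultimately show False using off[of "- 1" w R] by simp
  qed
  have "R = x - P'"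
    using sp_basis_expansion[of x y P P' R] c PP o RP' Ry RQ by (simp add: vals)
  then have "w = P - P' - y" using wR by (simp add: z_def)
  with w(1) show ?thesis by simp
qed

lemma no_bend:
  assumes L: "live x y (P - x - y)" and L': "live x (y + P') (- x - y)" and PP: "sp P P' \<noteq> 0"
    and t: "weight x y (- x - y) \<noteq> 0"
  shows False
proof -
  define c where "c = sp x y"
  have P: "P = x + y + (P - x - y)" and P': "P' = x + (y + P') + (- x - y)" by simp_all
  have c: "c \<noteq> 0" "sp x y = c" using live_tri[OF L] by (simp_all add: tri_def c_def)
  have PP': "sp P P' = c" using bend_pairing[OF L L' PP] by (simp add: c_def)
  have o: "sp x P = 0" "sp y P = 0" "sp x P' = 0" "sp y P' = 0"
    using live_sum_orth[OF L P] live_sum_orth[OF L' P'] by simp_all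
  have o': "sp P x = 0" "sp P y = 0" "sp P' x = 0" "sp P' y = 0" "sp y x = - c" "sp P' P = - c"
    using o c PP' sp_swap[of P x] sp_swap[of P y] sp_swap[of P' x] sp_swap[of P' y] sp_swap[of y x] sp_swap[of P' P]
    by simp_all
  note vals = c(2) PP' o o'
  have K: "live x (y - P) (P - P' - y)" by (rule bend_forces_triangle[OF L L' PP t])
  have "live x (- x - y - P') (P' - P - (- x - y))"
  proof (rule bend_forces_triangle)
    show "live x (- x - y) (P' - x - (- x - y))" using live_swap[OF L'] by (simp add: add.commute)
    show "live x (- x - y + P) (- x - (- x - y))" using live_swap[OF L] by (simp add: algebra_simps)
    show "sp P' P \<noteq> 0" using c by (simp add: vals)
    show "weight x (- x - y) (- x - (- x - y)) \<noteq> 0" using t by (simp add: weight_swap[of x _ y])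
  qed
  then have K': "live x (P' - P + x + y) (- x - y - P')"
    using live_swap by (simp add: algebra_simps)
  have ne: "y - P \<noteq> P' - P + x + y" "P - P' - y \<noteq> - x - y - P'"
  proof -
    have neI: "a \<noteq> a'" if "sp y a \<noteq> sp y a'" for a a' using that by auto
    show "y - P \<noteq> P' - P + x + y" "P - P' - y \<noteq> - x - y - P'"
      by (rule neI, use c in \<open>simp add: vals\<close>)+
  qed
  \<comment> \<open>The triangle and its mirror image are compared at the apex \<open>x\<close>: up
    to sign both candidates pair with \<open>y - P\<close> to \<open>c + c\<close>, which is
    nonzero.\<close>
  have "\<exists>g\<in>{P' - P + x + y, - x - y - P'}. sp (y - P) g = 0 \<and> sp (P - P' - y) g = 0"
    by (rule live_orth_apex[OF K K' _ ne refl refl]) (use c in \<open>simp_all add: vals\<close>)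
  then show False
    using c by (auto simp: vals F3_double)
qed

section \<open>One point for all edges of a triangle\<close>

text \<open>\<open>no_bend\<close> makes the two points orthogonal. Both are orthogonal to
  \<open>u\<close> and \<open>v\<close>, so they are parallel.\<close>

lemma same_point:
  assumes t: "weight u v w \<noteq> 0" "tri u v w" "u + v + w = 0"
    and L: "live u v q" and P: "P = u + v + q" "P \<noteq> 0"
    and L': "live u w q'" and P': "P' = u + w + q'" "P' \<noteq> 0"
  shows "P' \<in> {P, - P}"
proof -
  have w: "w = - u - v" using t(3) by (simp add: eq_neg_iff_add_eq_0 algebra_simps)
  have "sp P P' = 0"
  proof (rule ccontr)
    assume PP: "sp P P' \<noteq> 0"
    have "q' = v + P'" by (simp add: P' w)
    then have "live u (v + P') (- u - v)" using live_swap[OF L'] w by simp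
    moreover have "live u v (P - u - v)" using L by (simp add: P)
    ultimately show False using no_bend PP t(1) w by blast
  qed
  moreover have "sp u P' = 0" "sp v P' = 0"
    using live_sum_orth[OF L' P'(1)] by (simp_all add: w)
  moreover have "sp u v \<noteq> 0" using t(2) by (simp add: tri_def)
  ultimately have "P' \<in> {0, P, - P}"
    using sp_parallel[of u v P P'] live_sum_orth[OF L P(1)] P(2) by blast
  with P' show ?thesis by blast
qed

text \<open>If \<open>u + v + w = 0\<close>, the nonzero weight must be cancelled along the edge
  \<open>u v\<close> by another live triangle, and only \<open>w\<close> completes the sum to
  zero.\<close>

lemma edge_point_exists:
  assumes "weight u v w \<noteq> 0" "tri u v w"
  shows "\<exists>q. live u v q \<and> u + v + q \<noteq> 0"
proof (cases "u + v + w = 0")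
  case False
  then show ?thesis using weight_nonzero_live[OF assms] by blast
next
  case True
  show ?thesis
  proof (rule ccontr)
    assume none: "\<not> ?thesis"
    have "q = w" if "u + v + q = 0" for q using that True by (metis add_left_cancel)
    then have "(\<Sum>q | tri u v q. weight u v q) = (\<Sum>q\<in>{w}. weight u v q)"
      by (intro sum.mono_neutral_right) (use assms none weight_nonzero_live in auto)
    then show False using weight_edge_sum[of u v] assms by (simp add: tri_def)
  qed
qed

text \<open>If the sum is nonzero it serves as \<open>P\<close>, by \<open>unique_point\<close> on
  each edge. If it is zero, a point over \<open>u v\<close> is carried to the other edges by
  \<open>same_point\<close>.\<close>

lemma common_point:
  assumes n: "weight u v w \<noteq> 0" and t: "tri u v w"
  obtains P where "P \<noteq> 0" "u + v + w \<in> {0, P, - P}" "sp u P = 0" "sp v P = 0" "sp w P = 0"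
    "\<And>q. live u v q \<Longrightarrow> u + v + q \<noteq> 0 \<Longrightarrow> u + v + q \<in> {P, - P}"
    "\<And>q. live v w q \<Longrightarrow> v + w + q \<noteq> 0 \<Longrightarrow> v + w + q \<in> {P, - P}"
    "\<And>q. live w u q \<Longrightarrow> w + u + q \<noteq> 0 \<Longrightarrow> w + u + q \<in> {P, - P}"
proof (cases "u + v + w = 0")
  case False
  have L: "live u v w" using weight_nonzero_live[OF n t] .
  have r: "u + v + w = v + w + u" "u + v + w = w + u + v" by simp_all
  show thesis
    by (rule that[OF False])
      (use live_sum_orth[OF L refl] unique_point[OF L _ refl False refl]
        unique_point[OF live_rotate[OF L] _ r(1) False refl]
        unique_point[OF live_rotate[OF live_rotate[OF L]] _ r(2) False refl] in simp_all)
next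
  case True
  obtain q where q: "live u v q" "u + v + q \<noteq> 0" using edge_point_exists[OF n t] by blast
  define P where "P = u + v + q"
  have P0: "P \<noteq> 0" using q by (simp add: P_def)
  have 2: "w + u + q' \<in> {P, - P}" if "live w u q'" "w + u + q' \<noteq> 0" for q'
    using same_point[OF n t True q(1) P_def P0 live_flip[OF that(1)] refl] that(2)
    by (simp add: add.commute[of u w])
  have 3: "v + w + q' \<in> {P, - P}" if "live v w q'" "v + w + q' \<noteq> 0" for q'
  proof -
    have "weight v u w \<noteq> 0" "tri v u w" "v + u + w = 0" "live v u q" "P = v + u + q"
      using n t True q tri_flip live_flip by (simp_all add: weight_flip P_def add.commute[of v u])
    from same_point[OF this P0 that(1) refl that(2)] show ?thesis .
  qed
  have "sp u P = 0" "sp v P = 0" using live_sum_orth[OF q(1) P_def] by simp_all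
  moreover have "w = - u - v" using True by (simp add: eq_neg_iff_add_eq_0 algebra_simps)
  ultimately show thesis
    using that[OF P0 _ _ _ _ _ 3 2] True unique_point[OF q(1) _ P_def P0 refl] by simp
qed

section \<open>Summing over all triangles\<close>

text \<open>A triangle with point \<open>P\<close> has its three vertices in distinct cosets modulo \<open>P\<close>, and each edge
  determines \<open>P\<close> and the coset \<open>- u - v\<close> of the opposite vertex. So \<open>f\<close> can single out the edge opposite
  to the coset with the least code \<open>m\<close>.\<close>

lemma edge_weighting:
  obtains f :: "F3 ^ 4 \<Rightarrow> F3 ^ 4 \<Rightarrow> F3"
  where "\<And>u v w. weight u v w \<noteq> 0 \<Longrightarrow> tri u v w \<Longrightarrow> f u v + f v w + f w u = 1"
proof -
  obtain e :: "F3 ^ 4 \<Rightarrow> nat" where e: "inj e"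
    using finite_imp_inj_to_nat_seg[OF finite_class.finite_UNIV] by blast
  define m where "m P u = Min {e u, e (u + P), e (u - P)}" for P u
  \<comment> \<open>Over an edge of a triangle of nonzero weight the choice is unique up to sign,
    and \<open>m_neg\<close> makes the sign irrelevant.\<close>
  define pt where "pt u v = (SOME P. \<exists>q. live u v q \<and> P = u + v + q \<and> P \<noteq> 0)" for u v
  define f :: "F3 ^ 4 \<Rightarrow> F3 ^ 4 \<Rightarrow> F3" where
    "f u v = (if m (pt u v) (- u - v) < m (pt u v) u \<and> m (pt u v) (- u - v) < m (pt u v) v then 1 else 0)"
    for u v
  have dbl: "P + P = - P" for P :: "F3 ^ 4" by (rule F3_vector_double)
  have m_neg: "m (- P) u = m P u" for P u
  proof -
    have "{e u, e (u + - P), e (u - - P)} = {e u, e (u + P), e (u - P)}" by auto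
    then show ?thesis by (simp only: m_def)
  qed
  have m_add: "m P (u + P) = m P u" for P u
  proof -
    have "u + P + P = u - P" using dbl[of P] by (simp add: add.assoc)
    moreover have "u + P - P = u" by simp
    ultimately have "{e (u + P), e (u + P + P), e (u + P - P)} = {e u, e (u + P), e (u - P)}"
      by (simp only:) blast
    then show ?thesis by (simp only: m_def)
  qed
  then have m_diff: "m P (u - P) = m P u" for P u
    by (metis diff_add_cancel)
  \<comment> \<open>Equal codes mean equal cosets modulo \<open>P\<close>. Since \<open>P\<close> is
    orthogonal to \<open>u\<close>, pairing with \<open>u\<close> is constant on a coset, and it
    separates \<open>u\<close> from \<open>v\<close>.\<close>
  have m_ne: "m P u \<noteq> m P v" if "sp u P = 0" "sp u v \<noteq> 0" for P u v
  proof
    assume eq: "m P u = m P v"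
    have mem: "\<exists>a\<in>{0, P, - P}. m P z = e (z + a)" for z
    proof -
      have "m P z \<in> {e z, e (z + P), e (z - P)}" unfolding m_def by (rule Min_in) simp_all
      then show ?thesis by auto
    qed
    obtain a a' where "a \<in> {0, P, - P}" "a' \<in> {0, P, - P}" "e (u + a) = e (v + a')"
      using mem[of u] mem[of v] eq by metis
    then have a: "a \<in> {0, P, - P}" "a' \<in> {0, P, - P}" "u + a = v + a'"
      using injD[OF e] by blast+
    then have "sp u (u + a) = sp u (v + a')" by simp
    moreover have "sp u a = 0" "sp u a' = 0" using a that by auto
    ultimately show False using that by simp
  qed
  have pt: "pt u v \<in> {P, - P}"
    if "weight u v w \<noteq> 0" "tri u v w" and "\<And>q. live u v q \<Longrightarrow> u + v + q \<noteq> 0 \<Longrightarrow> u + v + q \<in> {P, - P}"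
    for u v w P
  proof -
    have "\<exists>P q. live u v q \<and> P = u + v + q \<and> P \<noteq> 0"
      using edge_point_exists[OF that(1,2)] by blast
    then have "\<exists>q. live u v q \<and> pt u v = u + v + q \<and> pt u v \<noteq> 0"
      unfolding pt_def by (rule someI_ex)
    with that(3) show ?thesis by metis
  qed
  have f: "f u v = (if m P w < m P u \<and> m P w < m P v then 1 else 0)"
    if "pt u v \<in> {P, - P}" "u + v + w \<in> {0, P, - P}" for u v w P
  proof -
    have "m (pt u v) q = m P q" for q using that(1) m_neg by auto
    moreover have "m P (- u - v) = m P w"
    proof -
      define s where "s = u + v + w"
      have "- u - v = w - s" by (simp add: s_def)
      moreover have "m P (w - s) = m P w"
        using that(2) m_add[of P w] m_diff[of P w] unfolding s_def[symmetric] by auto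
      ultimately show ?thesis by simp
    qed
    ultimately show ?thesis by (simp add: f_def)
  qed
  show thesis
  proof (rule that)
    fix u v w assume n: "weight u v w \<noteq> 0" and t: "tri u v w"
    obtain P where P: "u + v + w \<in> {0, P, - P}" "sp u P = 0" "sp v P = 0" "sp w P = 0"
      and pts: "\<And>q. live u v q \<Longrightarrow> u + v + q \<noteq> 0 \<Longrightarrow> u + v + q \<in> {P, - P}"
        "\<And>q. live v w q \<Longrightarrow> v + w + q \<noteq> 0 \<Longrightarrow> v + w + q \<in> {P, - P}"
        "\<And>q. live w u q \<Longrightarrow> w + u + q \<noteq> 0 \<Longrightarrow> w + u + q \<in> {P, - P}"
      using common_point[OF n t] by metis
    have n': "weight v w u \<noteq> 0" "weight w u v \<noteq> 0" using n by (simp_all add: weight_rotate)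
    have t': "tri v w u" "tri w u v" using t tri_rotate by blast+
    have s: "v + w + u = u + v + w" "w + u + v = u + v + w" by simp_all
    have fs: "f u v = (if m P w < m P u \<and> m P w < m P v then 1 else 0)"
      "f v w = (if m P u < m P v \<and> m P u < m P w then 1 else 0)"
      "f w u = (if m P v < m P w \<and> m P v < m P u then 1 else 0)"
      using f[OF pt[OF n t pts(1)] P(1)] f[OF pt[OF n'(1) t'(1) pts(2)], of u]
        f[OF pt[OF n'(2) t'(2) pts(3)], of v] P(1) unfolding s by blast+
    have "m P u \<noteq> m P v" "m P v \<noteq> m P w" "m P w \<noteq> m P u"
      by (rule m_ne, use P t t' in \<open>simp_all add: tri_def\<close>)+
    then show "f u v + f v w + f w u = 1" unfolding fs by auto
  qed
qed

text \<open>Exchanging two vertices negates all pairings, so the value \<open>1\<close> selects one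
  of the two cyclic orders.\<close>

definition oriented :: "F3 ^ 4 \<Rightarrow> F3 ^ 4 \<Rightarrow> F3 ^ 4 \<Rightarrow> bool" where
  "oriented u v w \<longleftrightarrow> sp u v = 1 \<and> sp v w = 1 \<and> sp w u = 1"

text \<open>The least code at \<open>u\<close> selects one rotation; counting all three would
  multiply by \<open>3 = 0\<close>. The \<open>f\<close>-weighted sum over all oriented triples
  vanishes edge by edge, and rotating its three parts to the leading form collects the coefficient
  \<open>f u v + f v w + f w u = 1\<close>.\<close>

lemma sum_weight_leading:
  fixes e :: "F3 ^ 4 \<Rightarrow> nat"
  assumes e: "inj e"
  shows "(\<Sum>(u, v, w) | oriented u v w \<and> e u < e v \<and> e u < e w. weight u v w) = 0"
proof -
  let ?T = "{(u, v, w). oriented u v w}"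
  let ?A = "{(u, v, w). oriented u v w \<and> e u < e v \<and> e u < e w}"
  let ?B = "{(u, v, w). oriented u v w \<and> e w < e u \<and> e w < e v}"
  let ?C = "{(u, v, w). oriented u v w \<and> e v < e w \<and> e v < e u}"
  obtain f :: "F3 ^ 4 \<Rightarrow> F3 ^ 4 \<Rightarrow> F3"
    where f: "\<And>u v w. weight u v w \<noteq> 0 \<Longrightarrow> tri u v w \<Longrightarrow> f u v + f v w + f w u = 1"
    using edge_weighting by blast
  define g where "g = (\<lambda>(u, v, w). f u v * weight u v w)"
  have distinct: "u \<noteq> v" "v \<noteq> w" "w \<noteq> u" if "oriented u v w" for u v w
    using that by (auto simp: oriented_def)
  have T: "?T = ?A \<union> (?B \<union> ?C)"
  proof (intro equalityI subsetI)
    fix t assume "t \<in> ?T"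
    then obtain u v w where t: "t = (u, v, w)" "oriented u v w" by auto
    then have "e u \<noteq> e v" "e v \<noteq> e w" "e w \<noteq> e u" using distinct[OF t(2)] e by (simp_all add: inj_eq)
    then show "t \<in> ?A \<union> (?B \<union> ?C)" using t by auto
  qed auto
  have "0 = (\<Sum>(u, v)\<in>{(u, v). sp u v = 1}. f u v * (\<Sum>w | tri u v w. weight u v w))"
    by (intro sum.neutral[symmetric]) (auto simp: weight_edge_sum)
  also have "\<dots> = (\<Sum>(u, v)\<in>{(u, v). sp u v = 1}. \<Sum>w | tri u v w. f u v * weight u v w)"
    by (simp add: sum_distrib_left)
  also have "\<dots> = (\<Sum>(p, w)\<in>(SIGMA p:{(u, v). sp u v = 1}. {w. tri (fst p) (snd p) w}).
      f (fst p) (snd p) * weight (fst p) (snd p) w)"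
    by (simp add: case_prod_unfold sum.Sigma)
  also have "\<dots> = sum g ?T"
    by (rule sum.reindex_bij_witness[of _ "\<lambda>(u, v, w). ((u, v), w)" "\<lambda>((u, v), w). (u, v, w)"])
      (auto simp: g_def oriented_def tri_def)
  also have "\<dots> = sum g ?A + (sum g ?B + sum g ?C)"
    unfolding T by (subst sum.union_disjoint, simp_all, force)+
  also have "sum g ?B = (\<Sum>(u, v, w)\<in>?A. f v w * weight u v w)"
    by (rule sum.reindex_bij_witness[of _ "\<lambda>(u, v, w). (v, w, u)" "\<lambda>(u, v, w). (w, u, v)"])
      (auto simp: g_def oriented_def weight_rotate)
  also have "sum g ?C = (\<Sum>(u, v, w)\<in>?A. f w u * weight u v w)"
    by (rule sum.reindex_bij_witness[of _ "\<lambda>(u, v, w). (w, u, v)" "\<lambda>(u, v, w). (v, w, u)"])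
      (auto simp: g_def oriented_def weight_rotate)
  also have "sum g ?A + ((\<Sum>(u, v, w)\<in>?A. f v w * weight u v w) + (\<Sum>(u, v, w)\<in>?A. f w u * weight u v w)) =
      (\<Sum>(u, v, w)\<in>?A. (f u v + f v w + f w u) * weight u v w)"
    by (simp add: g_def sum.distrib[symmetric] case_prod_beta algebra_simps)
  also have "\<dots> = (\<Sum>(u, v, w)\<in>?A. weight u v w)"
  proof (rule sum.cong[OF refl], clarify)
    fix u v w assume "oriented u v w"
    then have "tri u v w" by (simp add: oriented_def tri_def)
    then show "(f u v + f v w + f w u) * weight u v w = weight u v w"
      using f[of u v w] by (cases "weight u v w = 0") auto
  qed
  finally show ?thesis by simp
qed

text \<open>Each triangle of indices has exactly one leading oriented listing. Grouping these
  listings by projections gives the sum of weights already shown to vanish.\<close>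

theorem sum_triangles:
  "(\<Sum>K | \<exists>i j k. K = {i, j, k} \<and> K \<subseteq> I \<and> tri (b i) (b j) (b k). N K) = 0"
proof -
  obtain e :: "F3 ^ 4 \<Rightarrow> nat" where e: "inj e"
    using finite_imp_inj_to_nat_seg[OF finite_class.finite_UNIV] by blast
  let ?lead = "\<lambda>u v w. oriented u v w \<and> e u < e v \<and> e u < e w"
  let ?X = "{(i, j, k). i \<in> I \<and> j \<in> I \<and> k \<in> I \<and> ?lead (b i) (b j) (b k)}"
  let ?K = "{K. \<exists>i j k. K = {i, j, k} \<and> K \<subseteq> I \<and> tri (b i) (b j) (b k)}"
  \<comment> \<open>The least code identifies the first index, and the orientation orders the other
    two.\<close>
  have inj: "inj_on (\<lambda>(i, j, k). {i, j, k}) ?X"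
  proof (rule inj_onI)
    fix s t assume s: "s \<in> ?X" and t: "t \<in> ?X" and st: "(\<lambda>(i, j, k). {i, j, k}) s = (\<lambda>(i, j, k). {i, j, k}) t"
    obtain i j k where si: "s = (i, j, k)" by (rule prod_cases3)
    obtain i' j' k' where ti: "t = (i', j', k')" by (rule prod_cases3)
    have a: "?lead (b i) (b j) (b k)" "?lead (b i') (b j') (b k')" and eq: "{i, j, k} = {i', j', k'}"
      using s t st unfolding si ti by simp_all
    then have a': "e (b i) < e (b j)" "e (b i) < e (b k)" "e (b i') < e (b j')" "e (b i') < e (b k')" by auto
    have "i = i'" using eq a' by (metis insertE insertI1 less_asym singletonD)
    moreover have o: "sp (b i) (b j) = 1" "sp (b i') (b j') = 1" "sp (b k) (b i) = 1" "sp (b k') (b i') = 1"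
      using a by (auto simp: oriented_def)
    have d: "i \<noteq> j" "i \<noteq> k" "i' \<noteq> j'" "i' \<noteq> k'" using o by auto
    have "j \<noteq> k'"
    proof
      assume "j = k'"
      then have "sp (b i) (b j) = - 1" using o \<open>i = i'\<close> sp_swap[of "b i" "b k'"] by simp
      with o show False by simp
    qed
    then have "j = j'" using eq d \<open>i = i'\<close> by (metis insertE insertI1 insertI2 singletonD)
    moreover have "k \<noteq> j'"
    proof
      assume "k = j'"
      then have "sp (b k) (b i) = - 1" using o \<open>i = i'\<close> sp_swap[of "b j'" "b i"] by simp
      with o show False by simp
    qed
    then have "k = k'" using eq d \<open>i = i'\<close> by (metis insertE insertI1 insertI2 singletonD)
    ultimately show "s = t" by (simp add: si ti)
  qed
  have img: "(\<lambda>(i, j, k). {i, j, k}) ` ?X = ?K"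
  proof (intro equalityI subsetI)
    fix K assume "K \<in> (\<lambda>(i, j, k). {i, j, k}) ` ?X"
    then obtain i j k where "K = {i, j, k}" "i \<in> I" "j \<in> I" "k \<in> I" "oriented (b i) (b j) (b k)" by auto
    moreover from this have "tri (b i) (b j) (b k)" by (simp add: oriented_def tri_def)
    ultimately show "K \<in> ?K" by blast
  next
    fix K assume "K \<in> ?K"
    then obtain i j k where K: "K = {i, j, k}" "K \<subseteq> I" and t: "tri (b i) (b j) (b k)" by blast
    obtain i j k where K: "K = {i, j, k}" "K \<subseteq> I" and o: "oriented (b i) (b j) (b k)"
    proof (cases "sp (b i) (b j) = 1")
      case True
      then show thesis using that[of i j k] K t by (simp add: oriented_def tri_def)
    next
      case False
      then have "sp (b i) (b j) = - 1" using t F3_cases[of "sp (b i) (b j)"] by (simp add: tri_def)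
      moreover have "tri (b j) (b i) (b k)" using t by (rule tri_flip)
      ultimately show thesis using that[of j i k] K sp_swap[of "b j" "b i"]
        by (simp add: oriented_def tri_def insert_commute[of j i])
    qed
    then have "b i \<noteq> b j" "b j \<noteq> b k" "b k \<noteq> b i" by (auto simp: oriented_def)
    then have "e (b i) \<noteq> e (b j)" "e (b j) \<noteq> e (b k)" "e (b k) \<noteq> e (b i)"
      using e by (simp_all add: inj_eq)
    then have "?lead (b i) (b j) (b k) \<or> ?lead (b j) (b k) (b i) \<or> ?lead (b k) (b i) (b j)"
      using o by (auto simp: oriented_def)
    then have "(i, j, k) \<in> ?X \<or> (j, k, i) \<in> ?X \<or> (k, i, j) \<in> ?X" using K by auto
    moreover have "K = {j, k, i}" "K = {k, i, j}" using K by auto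
    ultimately obtain t where "t \<in> ?X" "K = (\<lambda>(i, j, k). {i, j, k}) t"
      using K(1) by (metis (mono_tags, lifting) case_prod_conv)
    then show "K \<in> (\<lambda>(i, j, k). {i, j, k}) ` ?X" by (rule rev_image_eqI)
  qed
  have "(\<Sum>K\<in>?K. N K) = (\<Sum>(i, j, k)\<in>?X. N {i, j, k})"
    unfolding img[symmetric] sum.reindex[OF inj]
    by (rule sum.cong[OF refl]) (simp only: comp_def case_prod_unfold)
  also have "\<dots> = (\<Sum>(u, v, w) | ?lead u v w. weight u v w)"
  proof -
    have "(\<Sum>(u, v, w) | ?lead u v w. weight u v w) =
        (\<Sum>t | case t of (u, v, w) \<Rightarrow> ?lead u v w. \<Sum>(i, j, k)\<in>fiber (fst t) \<times> fiber (fst (snd t)) \<times> fiber (snd (snd t)). N {i, j, k})"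
      by (rule sum.cong[OF refl]) (auto simp: weight_def sum.cartesian_product)
    also have "\<dots> = (\<Sum>(i, j, k)\<in>(\<Union>t\<in>{t. case t of (u, v, w) \<Rightarrow> ?lead u v w}. fiber (fst t) \<times> fiber (fst (snd t)) \<times> fiber (snd (snd t))). N {i, j, k})"
      by (rule sum.UNION_disjoint[symmetric])
        (auto simp: finite_fiber intro: finite_subset[OF subset_UNIV finite_class.finite_UNIV], auto simp: fiber_def)
    also have "(\<Union>t\<in>{t. case t of (u, v, w) \<Rightarrow> ?lead u v w}. fiber (fst t) \<times> fiber (fst (snd t)) \<times> fiber (snd (snd t))) = ?X"
      by (auto simp: fiber_def)
    finally show ?thesis by simp
  qed
  also have "\<dots> = 0" by (rule sum_weight_leading[OF e])
  finally show ?thesis .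
qed

end

section \<open>Reduction to the nondegenerate part\<close>

lemma balanced_iff_tri:
  assumes form: "\<And>i j. i < length S \<Longrightarrow> j < length S \<Longrightarrow> \<omega> (S ! i) (S ! j) = sp (b i) (b j)"
  shows "balanced \<omega> S K \<longleftrightarrow> (\<exists>i j k. K = {i, j, k} \<and> K \<subseteq> {..<length S} \<and> tri (b i) (b j) (b k))"
proof
  assume "balanced \<omega> S K"
  then obtain i j k where K: "K = {i, j, k}" "K \<subseteq> {..<length S}"
    and eq: "\<omega> (S ! i) (S ! j) = \<omega> (S ! j) (S ! k)" "\<omega> (S ! j) (S ! k) = \<omega> (S ! k) (S ! i)"
      "\<omega> (S ! k) (S ! i) \<noteq> 0"
    unfolding balanced_def by blast
  from K have "i < length S" "j < length S" "k < length S" by auto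
  then have "tri (b i) (b j) (b k)" using eq by (simp add: form tri_def)
  with K show "\<exists>i j k. K = {i, j, k} \<and> K \<subseteq> {..<length S} \<and> tri (b i) (b j) (b k)" by blast
next
  assume "\<exists>i j k. K = {i, j, k} \<and> K \<subseteq> {..<length S} \<and> tri (b i) (b j) (b k)"
  then obtain i j k where K: "K = {i, j, k}" "K \<subseteq> {..<length S}" and t: "tri (b i) (b j) (b k)"
    by blast
  from K have "i < length S" "j < length S" "k < length S" by auto
  moreover have "distinct [i, j, k]" using t by (auto simp: tri_def)
  ultimately show "balanced \<omega> S K" unfolding balanced_def using K t
    by (intro exI[of _ i] exI[of _ j] exI[of _ k]) (simp add: form tri_def)
qed

text \<open>The edge excludes the commuting alternative, so \<open>i\<close> and \<open>j\<close>
  belong to the unique balanced triple of the block.\<close>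

lemma no_full_triangle:
  assumes form: "\<And>i j. i < length S \<Longrightarrow> j < length S \<Longrightarrow> \<omega> (S ! i) (S ! j) = sp (b i) (b j)"
    and full: "no_full \<omega> S" and B: "vector_zero S B" "i \<in> B" "j \<in> B" and W: "sp (b i) (b j) \<noteq> 0"
  shows "\<exists>k\<in>B. tri (b i) (b j) (b k) \<and> (\<forall>l\<in>B - {i, j, k}. \<forall>m\<in>B. sp (b l) (b m) = 0)"
proof -
  have sub: "l < length S" if "l \<in> B" for l using B(1) that by (auto simp: vector_zero_def)
  have edge: "{l, m} \<in> nonorth_edges \<omega> S B" if "l \<in> B" "m \<in> B" "sp (b l) (b m) \<noteq> 0" for l m
  proof -
    have "l \<noteq> m" using that by auto
    with that form[OF sub sub] show ?thesis unfolding nonorth_edges_def by fastforce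
  qed
  obtain K where K: "K \<subseteq> B" "balanced \<omega> S K" "nonorth_edges \<omega> S B = {e. e \<subseteq> K \<and> card e = 2}"
    using full B(1) edge[OF B(2,3) W] unfolding no_full_def by blast
  obtain x y z where xyz: "K = {x, y, z}" and t: "tri (b x) (b y) (b z)"
    using K(2) balanced_iff_tri[where \<omega> = \<omega> and S = S and b = b, of K] form by blast
  have ijK: "i \<in> K" "j \<in> K" using edge[OF B(2,3) W] K(3) by auto
  have "i \<noteq> j" using W by auto
  then obtain k where k: "K = {i, j, k}" "tri (b i) (b j) (b k)"
    using edge_of_triangle[where b = b, OF t, of i j] ijK unfolding xyz by metis
  moreover have "sp (b l) (b m) = 0" if "l \<in> B - {i, j, k}" "m \<in> B" for l m
    using edge[of l m] that K(3) k(1) by auto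
  ultimately show ?thesis using K(1) by blast
qed

lemma direct_sum_proj:
  assumes "direct_sum P R"
  shows "proj_along P R v \<in> P" "v - proj_along P R v \<in> R"
    and "p \<in> P \<Longrightarrow> v - p \<in> R \<Longrightarrow> proj_along P R v = p"
proof -
  have P: "vec.subspace P" and R: "vec.subspace R" and PR: "P \<inter> R = {0}"
    and span: "{p + q | p q. p \<in> P \<and> q \<in> R} = UNIV"
    using assms by (auto simp: direct_sum_def)
  have unique: "p = p'" if "p \<in> P" "v - p \<in> R" "p' \<in> P" "v - p' \<in> R" for p p'
  proof -
    have "p - p' \<in> P" using P that by (simp add: vec.subspace_diff)
    moreover have "(v - p') - (v - p) \<in> R" using R that by (blast intro: vec.subspace_diff)
    then have "p - p' \<in> R" by simp
    ultimately have "p - p' = 0" using PR by blast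
    then show ?thesis by simp
  qed
  have "v \<in> {p + q | p q. p \<in> P \<and> q \<in> R}" using span by simp
  then obtain x y where "v = x + y" "x \<in> P" "y \<in> R" by blast
  then have ex: "\<exists>!p. p \<in> P \<and> v - p \<in> R"
    using unique by (intro ex1I[of _ x]) auto
  from theI'[OF ex] show "proj_along P R v \<in> P" "v - proj_along P R v \<in> R"
    by (auto simp: proj_along_def)
  then show "p \<in> P \<Longrightarrow> v - p \<in> R \<Longrightarrow> proj_along P R v = p"
    using unique by blast
qed

theorem theorem4p3:
  fixes r a :: nat
    and P R :: "(F3 ^ 'd) set"
    and \<iota> :: "F3 ^ 4 \<Rightarrow> F3 ^ 'd"
    and \<omega> :: "F3 ^ 'd \<Rightarrow> F3 ^ 'd \<Rightarrow> F3"
    and S :: "(F3 ^ 'd) list"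
  assumes "a = r + 4"
    and "CARD('d) = a"
    and "direct_sum P R"
    and "Vector_Spaces.linear (*s) (*s) \<iota>" and "inj \<iota>" and "range \<iota> = P"
    and "vec.dim R = r"
    and "alternating_form \<omega>"
    and "radical \<omega> = R"
    and "\<And>x y. \<omega> (\<iota> x) (\<iota> y) = symplectic4 x y"
    and "no_full \<omega> S"
    and "length S = 2 * a + 3"
    and "\<And>i. i < length S \<Longrightarrow> proj_along P R (S ! i) \<noteq> 0"
  shows "Theta \<omega> S = 0"
proof -
  interpret \<iota>: Vector_Spaces.linear "(*s)" "(*s)" \<iota> by (fact assms(4))
  have lin: "Vector_Spaces.linear (*s) (*) (\<omega> x)" "Vector_Spaces.linear (*s) (*) (\<lambda>y. \<omega> y x)" for x
    using assms(8) by (auto simp: alternating_form_def)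
  have add: "\<omega> x (y + z) = \<omega> x y + \<omega> x z" "\<omega> (y + z) x = \<omega> y x + \<omega> z x" for x y z
    using lin[of x] by (simp_all add: Vector_Spaces.linear_def module_hom_def module_hom_axioms_def)
  have swap: "\<omega> y x = - \<omega> x y" for x y
  proof -
    have "\<omega> (x + y) (x + y) = 0" "\<omega> x x = 0" "\<omega> y y = 0"
      using assms(8) by (simp_all add: alternating_form_def)
    then have "\<omega> x y + \<omega> y x = 0" by (simp add: add add.commute)
    then show ?thesis by (metis add_eq_0_iff)
  qed
  define b where "b i = inv \<iota> (proj_along P R (S ! i))" for i
  have proj: "proj_along P R (S ! i) \<in> P" "S ! i - proj_along P R (S ! i) \<in> R" for i
    by (rule direct_sum_proj[OF assms(3)])+
  have \<iota>b: "\<iota> (b i) = proj_along P R (S ! i)" for i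
    using proj(1)[of i] assms(6) by (auto simp: b_def f_inv_into_f)
  have rad: "\<omega> x y = 0" "\<omega> y x = 0" if "x \<in> R" for x y
    using that assms(9) swap[of x y] by (auto simp: radical_def)
  have form: "\<omega> (S ! i) (S ! j) = sp (b i) (b j)" for i j
  proof -
    have "S ! i = \<iota> (b i) + (S ! i - \<iota> (b i))" "S ! j = \<iota> (b j) + (S ! j - \<iota> (b j))" by simp_all
    then have "\<omega> (S ! i) (S ! j) = \<omega> (\<iota> (b i)) (\<iota> (b j))"
      using add rad[of "S ! i - \<iota> (b i)"] rad[of "S ! j - \<iota> (b j)"] proj(2)[of i] proj(2)[of j] unfolding \<iota>b
      by (metis add.right_neutral)
    then show ?thesis by (simp add: assms(10))
  qed
  have sum_b: "(\<Sum>i\<in>B. b i) = 0" if "vector_zero S B" for B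
  proof -
    have R: "vec.subspace R" using assms(3) by (simp add: direct_sum_def)
    \<comment> \<open>The radical parts sum into \<open>R\<close>. As the block sums to zero, the
      image of the sum of projections lies in both \<open>P\<close> and \<open>R\<close>.\<close>
    have "(\<Sum>i\<in>B. S ! i - \<iota> (b i)) \<in> R" unfolding \<iota>b using proj(2) by (intro vec.subspace_sum[OF R])
    then have "0 - \<iota> (\<Sum>i\<in>B. b i) \<in> R" using that by (simp add: vector_zero_def sum_subtractf \<iota>.sum)
    then have "\<iota> (\<Sum>i\<in>B. b i) \<in> R" using vec.subspace_neg[OF R] by fastforce
    then have "\<iota> (\<Sum>i\<in>B. b i) = 0" using assms(3,6) by (auto simp: direct_sum_def)
    then show ?thesis using \<iota>.zero assms(5) by (metis injD)
  qed
  interpret triangle_blocks "{..<length S}" "{B. vector_zero S B}" b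
  proof
    fix i assume "i \<in> {..<length S}"
    then show "b i \<noteq> 0" using assms(13)[of i] \<iota>b[of i] by auto
  next
    fix B C assume "B \<in> {B. vector_zero S B}" "C \<in> {B. vector_zero S B}" "B \<inter> C = {}"
    then show "B \<union> C \<in> {B. vector_zero S B}"
      using finite_subset[of _ "{..<length S}"] by (auto simp: vector_zero_def sum.union_disjoint)
  next
    \<comment> \<open>The length \<open>2 * a + 3\<close> exceeds \<open>2 * a + card Y\<close>
      exactly when \<open>card Y\<close> is at most two.\<close>
    fix Y assume Y: "Y \<subseteq> {..<length S}" "card Y \<le> 2"
    then show "(\<Sum>B | B \<in> {B. vector_zero S B} \<and> Y \<subseteq> B. (-1::F3) ^ card B) = 0"
      using block_count_eq_0[of Y S] assms(2,12) by (simp add: block_count_def)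
  next
    fix B i j assume "B \<in> {B. vector_zero S B}" "i \<in> B" "j \<in> B" "sp (b i) (b j) \<noteq> 0"
    then show "\<exists>k\<in>B. tri (b i) (b j) (b k) \<and> (\<forall>l\<in>B - {i, j, k}. \<forall>m\<in>B. sp (b l) (b m) = 0)"
      using no_full_triangle[where \<omega> = \<omega> and S = S and b = b, OF form assms(11)] by simp
  qed (use sum_b in \<open>auto simp: vector_zero_def\<close>)
  have "N K = block_count S K" for K
    by (simp add: N_def block_count_def)
  then have "Theta \<omega> S = - (\<Sum>K | balanced \<omega> S K. N K)"
    by (simp add: Theta_def mu_def sum_negf)
  then show ?thesis
    unfolding balanced_iff_tri[where \<omega> = \<omega> and S = S and b = b, OF form] sum_triangles by simp
qed

end
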